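(* Let $A_0:B\to B$ be a linear map, and let $A:L^2(B)\to L^2(B)$ be the associated map, $A\Lambda(a)=\Lambda(A_0(a))$. Then $\Psi'(A_0)=\Psi'_{0,1/2}(A)$. The following are equivalent: (1) $A_0$ is completely positive, with $m(A_0\otimes A_0)m^*=A_0$; (2) $A$ is real and satisfies $m(A\otimes A)m^*=A$. Moreover, the following are equivalent: (3) $A_0$ is completely positive, and satisfies $m(A_0\otimes A_0)m^*=A_0$ and $(1\otimes\eta^*m)(1\otimes A_0\otimes1)(m^*\eta\otimes1)=A_0$; (4) $A$ is self-adjoint, and satisfies $m(A\otimes A)m^*=A$ and $(1\otimes\eta^*m)(1\otimes A\otimes1)(m^*\eta\otimes1)=A$.
   Context: $B$ is a finite-dimensional $C^*$-algebra, $\mathrm{Tr}$ the sum of the non-normalised traces of its matrix blocks, $\psi$ a faithful state on $B$, $Q\in B$ the positive invertible element with $\psi(a)=\mathrm{Tr}(Qa)$, and $\sigma_z(a)=Q^{iz}aQ^{-iz}$ for $z\in\mathbb C$, $a\in B$. Inner products are linear in the right variable and $\theta_{\xi,\eta}(\zeta)=(\xi|\zeta)\eta$ for vectors. $L^2(B)$ is the GNS space of $\psi$ with GNS map $\Lambda:B\to L^2(B)$ (a linear bijection), $(\Lambda(a)|\Lambda(b))=\psi(a^*b)$; $m:L^2(B)\otimes L^2(B)\to L^2(B)$ is $m(\Lambda(a)\otimes\Lambda(b))=\Lambda(ab)$ with Hilbert space adjoint $m^*$; $\eta:\mathbb C\to L^2(B)$, $\lambda\mapsto\lambda\Lambda(1)$,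 with adjoint $\eta^*$. Using the linear isomorphism $\Lambda$, the maps $m,m^*,\eta,\eta^*$ are also regarded as maps between $B\otimes B$, $B$ and $\mathbb C$, and the equations for $A_0$ are interpreted in this way. $A$ is called real when $A_0(a^* )=A_0(a)^*$ for all $a\in B$. $B^{\mathrm{op}}$ is $B$ with reversed product. $\Psi':\mathcal B(B)\to B\otimes B^{\mathrm{op}}$ is the linear map on linear maps $B\to B$ sending $\big(x\mapsto\psi(ax)c\big)$ to $c\otimes\sigma_{-i/2}(a)$ for $a,c\in B$. $\Psi'_{0,1/2}:\mathcal B(L^2(B))\to B\otimes B^{\mathrm{op}}$ is the linear map with $\theta_{\Lambda(a),\Lambda(b)}\mapsto b\otimes\sigma_{i/2}(a)^*$. *)

theory Defs
  imports "HOL-Analysis.Analysis" "HOL-Library.Nonpos_Ints" "Jordan_Normal_Form.Schur_Decomposition"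
begin

section \<open>Complex vector spaces\<close>

class scaleC =
  fixes scaleC :: "complex \<Rightarrow> 'a \<Rightarrow> 'a"  (infixr "*\<^sub>C" 75)

class complex_vector = ab_group_add + scaleC +
  assumes scaleC_add_right: "c *\<^sub>C (x + y) = c *\<^sub>C x + c *\<^sub>C y"
    and scaleC_add_left: "(c + d) *\<^sub>C x = c *\<^sub>C x + d *\<^sub>C x"
    and scaleC_scaleC: "c *\<^sub>C d *\<^sub>C x = (c * d) *\<^sub>C x"
    and scaleC_one: "1 *\<^sub>C x = x"

interpretation complex_vector: vector_space "scaleC :: complex \<Rightarrow> 'a \<Rightarrow> 'a::complex_vector"
  by standard (simp_all add: scaleC_add_right scaleC_add_left scaleC_scaleC scaleC_one)

instantiation complex :: complex_vector
begin
definition scaleC_complex_def: "c *\<^sub>C (x :: complex) = c * x"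
instance by standard (simp_all add: scaleC_complex_def algebra_simps)
end

abbreviation clinear :: "('a::complex_vector \<Rightarrow> 'b::complex_vector) \<Rightarrow> bool" where
  "clinear \<equiv> Vector_Spaces.linear scaleC scaleC"

definition cbilinear :: "('a::complex_vector \<Rightarrow> 'b::complex_vector \<Rightarrow> 'c::complex_vector) \<Rightarrow> bool" where
  "cbilinear \<beta> \<longleftrightarrow> (\<forall>x. clinear (\<beta> x)) \<and> (\<forall>y. clinear (\<lambda>x. \<beta> x y))"

lemma clinearI:
  assumes "\<And>x y. f (x + y) = f x + f y" and "\<And>c x. f (c *\<^sub>C x) = c *\<^sub>C f x"
  shows "clinear f"
  using assms by unfold_locales

lemma cbilinear_simps:
  assumes "cbilinear \<beta>"
  shows "\<beta> (x + x') y = \<beta> x y + \<beta> x' y" "\<beta> x (y + y') = \<beta> x y + \<beta> x y'"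
    and "\<beta> (c *\<^sub>C x) y = c *\<^sub>C \<beta> x y" "\<beta> x (c *\<^sub>C y) = c *\<^sub>C \<beta> x y"
proof -
  interpret l: Vector_Spaces.linear scaleC scaleC "\<lambda>x. \<beta> x y" for y
    using assms by (simp add: cbilinear_def)
  interpret r: Vector_Spaces.linear scaleC scaleC "\<beta> x" for x
    using assms by (simp add: cbilinear_def)
  show "\<beta> (x + x') y = \<beta> x y + \<beta> x' y" "\<beta> x (y + y') = \<beta> x y + \<beta> x y'"
    "\<beta> (c *\<^sub>C x) y = c *\<^sub>C \<beta> x y" "\<beta> x (c *\<^sub>C y) = c *\<^sub>C \<beta> x y"
    by (rule l.add r.add l.scale r.scale)+
qed


section \<open>Tensor products\<close>

text \<open>A list of pairs stands for the formal sum of the elementary tensors it contains. Two formal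
  sums are identified when every bilinear form takes the same value on them; since linear
  functionals separate the points of a complex vector space, this is the algebraic tensor
  product.\<close>

definition eval_pairs :: "('a \<Rightarrow> 'b \<Rightarrow> complex) \<Rightarrow> ('a \<times> 'b) list \<Rightarrow> complex" where
  "eval_pairs \<beta> xs = (\<Sum>(a, b)\<leftarrow>xs. \<beta> a b)"

definition tensor_rel ::
  "('a::complex_vector \<times> 'b::complex_vector) list \<Rightarrow> ('a \<times> 'b) list \<Rightarrow> bool" where
  "tensor_rel xs ys \<longleftrightarrow> (\<forall>\<beta>. cbilinear \<beta> \<longrightarrow> eval_pairs \<beta> xs = eval_pairs \<beta> ys)"

quotient_type (overloaded) ('a, 'b) tensor =
  "('a::complex_vector \<times> 'b::complex_vector) list" / tensor_rel
  by (intro equivpI reflpI sympI transpI) (auto simp: tensor_rel_def)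

lift_definition elem_tensor ::
  "'a::complex_vector \<Rightarrow> 'b::complex_vector \<Rightarrow> ('a, 'b) tensor"  (infixr "\<otimes>\<^sub>t" 72)
  is "\<lambda>a b. [(a, b)]" .

lemma eval_pairs_scale:
  assumes "cbilinear \<beta>"
  shows "eval_pairs \<beta> (map (\<lambda>(a, b). (c *\<^sub>C a, b)) xs) = c * eval_pairs \<beta> xs"
  by (induction xs)
    (auto simp: eval_pairs_def cbilinear_simps[OF assms] scaleC_complex_def algebra_simps)

lemma eval_pairs_append: "eval_pairs \<beta> (xs @ ys) = eval_pairs \<beta> xs + eval_pairs \<beta> ys"
  by (simp add: eval_pairs_def)

lemma eval_pairs_Nil: "eval_pairs \<beta> [] = 0"
  by (simp add: eval_pairs_def)

instantiation tensor :: (complex_vector, complex_vector) complex_vector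
begin

lift_definition zero_tensor :: "('a, 'b) tensor" is "[]" .

lift_definition plus_tensor :: "('a, 'b) tensor \<Rightarrow> ('a, 'b) tensor \<Rightarrow> ('a, 'b) tensor"
  is "\<lambda>xs ys. xs @ ys"
  by (auto simp: tensor_rel_def eval_pairs_append)

lift_definition scaleC_tensor :: "complex \<Rightarrow> ('a, 'b) tensor \<Rightarrow> ('a, 'b) tensor"
  is "\<lambda>c. map (\<lambda>(a, b). (c *\<^sub>C a, b))"
  by (auto simp: tensor_rel_def eval_pairs_scale)

definition uminus_tensor :: "('a, 'b) tensor \<Rightarrow> ('a, 'b) tensor" where
  "uminus_tensor t = (- 1) *\<^sub>C t"

definition minus_tensor :: "('a, 'b) tensor \<Rightarrow> ('a, 'b) tensor \<Rightarrow> ('a, 'b) tensor" where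
  "minus_tensor s t = s + (- t)"

instance
proof
  fix r s t :: "('a, 'b) tensor" and c d :: complex
  note eval = tensor_rel_def eval_pairs_append eval_pairs_scale eval_pairs_Nil distrib_left distrib_right ac_simps
  show "r + s + t = r + (s + t)" by transfer (simp add: eval)
  show "s + t = t + s" by transfer (simp add: eval)
  show "0 + t = t" by transfer (simp add: eval)
  show "s - t = s + - t" by (simp add: minus_tensor_def)
  show "c *\<^sub>C (s + t) = c *\<^sub>C s + c *\<^sub>C t" by transfer (simp add: eval)
  show dist: "(c + d) *\<^sub>C t = c *\<^sub>C t + d *\<^sub>C t" for c d :: complex
    by transfer (simp add: eval)
  show "c *\<^sub>C d *\<^sub>C t = (c * d) *\<^sub>C t" by transfer (simp add: eval del: map_map)
  show one: "1 *\<^sub>C t = t" by transfer (simp add: eval)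
  have "0 *\<^sub>C t = 0"
    by transfer (simp add: tensor_rel_def eval_pairs_scale eval_pairs_Nil del: complex_vector.scale_zero_left)
  then show "- t + t = 0"
    using dist[of "- 1" 1] by (simp add: uminus_tensor_def one)
qed

end

text \<open>Linear maps out of a tensor product are given by the universal property.\<close>

definition tensor_lift ::
  "('a::complex_vector \<Rightarrow> 'b::complex_vector \<Rightarrow> 'c::complex_vector) \<Rightarrow> ('a, 'b) tensor \<Rightarrow> 'c" where
  "tensor_lift \<beta> = (THE h. clinear h \<and> (\<forall>a b. h (a \<otimes>\<^sub>t b) = \<beta> a b))"

definition tensor_map ::
  "('a::complex_vector \<Rightarrow> 'c::complex_vector) \<Rightarrow> ('b::complex_vector \<Rightarrow> 'd::complex_vector)
    \<Rightarrow> ('a, 'b) tensor \<Rightarrow> ('c, 'd) tensor" where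
  "tensor_map f g = tensor_lift (\<lambda>a b. f a \<otimes>\<^sub>t g b)"

definition tensor_assoc ::
  "(('a::complex_vector, 'b::complex_vector) tensor, 'c::complex_vector) tensor
    \<Rightarrow> ('a, ('b, 'c) tensor) tensor" where
  "tensor_assoc = tensor_lift (\<lambda>s c. tensor_lift (\<lambda>a b. a \<otimes>\<^sub>t (b \<otimes>\<^sub>t c)) s)"

text \<open>The inner product of a tensor product of inner product spaces; as everywhere below, inner
  products are linear in the right variable.\<close>

definition tensor_ip ::
  "('a::complex_vector \<Rightarrow> 'a \<Rightarrow> complex) \<Rightarrow> ('b::complex_vector \<Rightarrow> 'b \<Rightarrow> complex)
    \<Rightarrow> ('a, 'b) tensor \<Rightarrow> ('a, 'b) tensor \<Rightarrow> complex" where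
  "tensor_ip ipV ipW = (THE S.
     (\<forall>s. clinear (S s)) \<and> (\<forall>t. clinear (\<lambda>s. cnj (S s t))) \<and>
     (\<forall>a b c d. S (a \<otimes>\<^sub>t b) (c \<otimes>\<^sub>t d) = ipV a c * ipW b d))"

definition hilbert_adj ::
  "('a::complex_vector \<Rightarrow> 'a \<Rightarrow> complex) \<Rightarrow> ('b::complex_vector \<Rightarrow> 'b \<Rightarrow> complex)
    \<Rightarrow> ('a \<Rightarrow> 'b) \<Rightarrow> 'b \<Rightarrow> 'a" where
  "hilbert_adj ipV ipW f = (THE g. clinear g \<and> (\<forall>v w. ipW w (f v) = ipV (g w) v))"

definition rank_one ::
  "('h::complex_vector \<Rightarrow> 'h \<Rightarrow> complex) \<Rightarrow> 'h \<Rightarrow> 'h \<Rightarrow> 'h \<Rightarrow> 'h" where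
  "rank_one ip \<xi> \<eta> = (\<lambda>\<zeta>. ip \<xi> \<zeta> *\<^sub>C \<eta>)"


section \<open>Finite-dimensional C*-algebras\<close>

class cstar_algebra = complex_vector + real_normed_algebra_1 + banach +
  fixes star :: "'a \<Rightarrow> 'a"
  assumes scaleR_scaleC: "r *\<^sub>R x = complex_of_real r *\<^sub>C x"
    and scaleC_mult_left: "(c *\<^sub>C x) * y = c *\<^sub>C (x * y)"
    and scaleC_mult_right: "x * (c *\<^sub>C y) = c *\<^sub>C (x * y)"
    and norm_scaleC: "norm (c *\<^sub>C x) = cmod c * norm x"
    and star_star: "star (star x) = x"
    and star_add: "star (x + y) = star x + star y"
    and star_scaleC: "star (c *\<^sub>C x) = cnj c *\<^sub>C star x"
    and star_mult: "star (x * y) = star y * star x"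
    and norm_star_mult: "norm (star x * x) = (norm x)\<^sup>2"

class fd_cstar_algebra = cstar_algebra +
  assumes finite_dimensional: "\<exists>S. finite S \<and> (\<forall>x. \<exists>c. x = (\<Sum>s\<in>S. c s *\<^sub>C s))"

definition cstar_pos :: "'b::cstar_algebra \<Rightarrow> bool" where
  "cstar_pos x \<longleftrightarrow> (\<exists>y. x = star y * y)"

text \<open>A *-isomorphism of the algebra with the direct sum of the full matrix algebras of sizes
  \<open>d 0, \<dots>, d (K - 1)\<close>; \<open>\<Phi> a k\<close> is the \<open>k\<close>-th matrix block of \<open>a\<close>.\<close>

definition matrix_blocks ::
  "nat \<Rightarrow> (nat \<Rightarrow> nat) \<Rightarrow> ('b::fd_cstar_algebra \<Rightarrow> nat \<Rightarrow> complex mat) \<Rightarrow> bool" where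
  "matrix_blocks K d \<Phi> \<longleftrightarrow>
     (\<forall>k<K. 0 < d k \<and>
       (\<forall>a. \<Phi> a k \<in> carrier_mat (d k) (d k)) \<and>
       (\<forall>a b. \<Phi> (a + b) k = \<Phi> a k + \<Phi> b k) \<and>
       (\<forall>c a. \<Phi> (c *\<^sub>C a) k = c \<cdot>\<^sub>m \<Phi> a k) \<and>
       (\<forall>a b. \<Phi> (a * b) k = \<Phi> a k * \<Phi> b k) \<and>
       (\<forall>a. \<Phi> (star a) k = mat_adjoint (\<Phi> a k))) \<and>
     (\<forall>a b. (\<forall>k<K. \<Phi> a k = \<Phi> b k) \<longrightarrow> a = b) \<and>
     (\<forall>M. (\<forall>k<K. M k \<in> carrier_mat (d k) (d k)) \<longrightarrow> (\<exists>a. \<forall>k<K. \<Phi> a k = M k))"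

definition block_trace ::
  "nat \<Rightarrow> (nat \<Rightarrow> nat) \<Rightarrow> ('b::fd_cstar_algebra \<Rightarrow> nat \<Rightarrow> complex mat) \<Rightarrow> 'b \<Rightarrow> complex" where
  "block_trace K d \<Phi> a = (\<Sum>k<K. \<Sum>i<d k. \<Phi> a k $$ (i, i))"

definition faithful_state :: "('b::cstar_algebra \<Rightarrow> complex) \<Rightarrow> bool" where
  "faithful_state \<psi> \<longleftrightarrow> clinear \<psi> \<and> \<psi> 1 = 1 \<and>
     (\<forall>a. cstar_pos a \<longrightarrow> \<psi> a \<in> \<real>\<^sub>\<ge>\<^sub>0) \<and> (\<forall>a. cstar_pos a \<longrightarrow> \<psi> a = 0 \<longrightarrow> a = 0)"

text \<open>Complex powers of a positive invertible element are \<open>Q\<^sup>w = exp (w log Q)\<close>, with the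
  self-adjoint logarithm of \<open>Q\<close>.\<close>

definition cstar_log :: "'b::cstar_algebra \<Rightarrow> 'b" where
  "cstar_log Q = (THE h. star h = h \<and> exp h = Q)"

definition cpower :: "'b::cstar_algebra \<Rightarrow> complex \<Rightarrow> 'b" where
  "cpower Q w = exp (w *\<^sub>C cstar_log Q)"

definition modular :: "'b::cstar_algebra \<Rightarrow> complex \<Rightarrow> 'b \<Rightarrow> 'b" where
  "modular Q z a = cpower Q (\<i> * z) * a * cpower Q (- (\<i> * z))"

definition mat_pos :: "nat \<Rightarrow> 'b::cstar_algebra mat \<Rightarrow> bool" where
  "mat_pos n X \<longleftrightarrow> (\<exists>Y \<in> carrier_mat n n. X = map_mat star (transpose_mat Y) * Y)"

definition completely_positive :: "('b::cstar_algebra \<Rightarrow> 'b) \<Rightarrow> bool" where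
  "completely_positive f \<longleftrightarrow> clinear f \<and> (\<forall>n X. mat_pos n X \<longrightarrow> mat_pos n (map_mat f X))"

definition real_map :: "('b::cstar_algebra \<Rightarrow> 'b) \<Rightarrow> bool" where
  "real_map f \<longleftrightarrow> (\<forall>a. f (star a) = star (f a))"


section \<open>The GNS space and its structure maps\<close>

text \<open>The second and third conditions determine the inner product \<open>ip\<close>; it is positive definite
  when \<open>\<psi>\<close> is faithful.\<close>

definition gns ::
  "('b::cstar_algebra \<Rightarrow> complex) \<Rightarrow> ('b \<Rightarrow> 'h::complex_vector) \<Rightarrow> ('h \<Rightarrow> 'h \<Rightarrow> complex) \<Rightarrow> bool" where
  "gns \<psi> \<Lambda> ip \<longleftrightarrow> clinear \<Lambda> \<and> bij \<Lambda> \<and> (\<forall>a b. ip (\<Lambda> a) (\<Lambda> b) = \<psi> (star a * b))"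

definition mult_H ::
  "('b::cstar_algebra \<Rightarrow> 'h::complex_vector) \<Rightarrow> ('h, 'h) tensor \<Rightarrow> 'h" where
  "mult_H \<Lambda> = tensor_lift (\<lambda>\<xi> \<zeta>. \<Lambda> (inv_into UNIV \<Lambda> \<xi> * inv_into UNIV \<Lambda> \<zeta>))"

definition comult_H ::
  "('b::cstar_algebra \<Rightarrow> 'h::complex_vector) \<Rightarrow> ('h \<Rightarrow> 'h \<Rightarrow> complex) \<Rightarrow> 'h \<Rightarrow> ('h, 'h) tensor" where
  "comult_H \<Lambda> ip = hilbert_adj (tensor_ip ip ip) ip (mult_H \<Lambda>)"

definition unit_H :: "('b::cstar_algebra \<Rightarrow> 'h::complex_vector) \<Rightarrow> complex \<Rightarrow> 'h" where
  "unit_H \<Lambda> = (\<lambda>c. c *\<^sub>C \<Lambda> 1)"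

definition counit_H ::
  "('b::cstar_algebra \<Rightarrow> 'h::complex_vector) \<Rightarrow> ('h \<Rightarrow> 'h \<Rightarrow> complex) \<Rightarrow> 'h \<Rightarrow> complex" where
  "counit_H \<Lambda> ip = hilbert_adj (\<lambda>w z. cnj w * z) ip (unit_H \<Lambda>)"

text \<open>The same maps, transported to the algebra along \<open>\<Lambda>\<close>.\<close>

definition mult_B ::
  "('b::cstar_algebra \<Rightarrow> 'h::complex_vector) \<Rightarrow> ('b, 'b) tensor \<Rightarrow> 'b" where
  "mult_B \<Lambda> = inv_into UNIV \<Lambda> \<circ> mult_H \<Lambda> \<circ> tensor_map \<Lambda> \<Lambda>"

definition comult_B ::
  "('b::cstar_algebra \<Rightarrow> 'h::complex_vector) \<Rightarrow> ('h \<Rightarrow> 'h \<Rightarrow> complex) \<Rightarrow> 'b \<Rightarrow> ('b, 'b) tensor" where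
  "comult_B \<Lambda> ip = tensor_map (inv_into UNIV \<Lambda>) (inv_into UNIV \<Lambda>) \<circ> comult_H \<Lambda> ip \<circ> \<Lambda>"

definition unit_B :: "('b::cstar_algebra \<Rightarrow> 'h::complex_vector) \<Rightarrow> complex \<Rightarrow> 'b" where
  "unit_B \<Lambda> = inv_into UNIV \<Lambda> \<circ> unit_H \<Lambda>"

definition counit_B ::
  "('b::cstar_algebra \<Rightarrow> 'h::complex_vector) \<Rightarrow> ('h \<Rightarrow> 'h \<Rightarrow> complex) \<Rightarrow> 'b \<Rightarrow> complex" where
  "counit_B \<Lambda> ip = counit_H \<Lambda> ip \<circ> \<Lambda>"

definition schur_square ::
  "(('v::complex_vector, 'v) tensor \<Rightarrow> 'v) \<Rightarrow> ('v \<Rightarrow> ('v, 'v) tensor) \<Rightarrow> ('v \<Rightarrow> 'v) \<Rightarrow> 'v \<Rightarrow> 'v" where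
  "schur_square m ms f = m \<circ> tensor_map f f \<circ> ms"

text \<open>\<open>(1 \<otimes> e m) (1 \<otimes> f \<otimes> 1) (ms u \<otimes> 1)\<close>, where \<open>V\<close> is identified with \<open>\<complex> \<otimes> V\<close> at the
  source and with \<open>V \<otimes> \<complex>\<close> at the target.\<close>

definition bend ::
  "(('v::complex_vector, 'v) tensor \<Rightarrow> 'v) \<Rightarrow> ('v \<Rightarrow> ('v, 'v) tensor)
    \<Rightarrow> (complex \<Rightarrow> 'v) \<Rightarrow> ('v \<Rightarrow> complex) \<Rightarrow> ('v \<Rightarrow> 'v) \<Rightarrow> 'v \<Rightarrow> 'v" where
  "bend m ms u e f =
     tensor_lift (\<lambda>v c. c *\<^sub>C v) \<circ> tensor_map id (e \<circ> m) \<circ> tensor_map id (tensor_map f id)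
       \<circ> tensor_assoc \<circ> tensor_map (ms \<circ> u) id \<circ> (\<lambda>v. 1 \<otimes>\<^sub>t v)"


section \<open>The opposite algebra and the maps into \<open>B \<otimes> B\<^sup>o\<^sup>p\<close>\<close>

typedef 'a opposite = "UNIV :: 'a set" morphisms from_opp to_opp ..

setup_lifting type_definition_opposite

instantiation opposite :: (ab_group_add) ab_group_add
begin
lift_definition zero_opposite :: "'a opposite" is 0 .
lift_definition plus_opposite :: "'a opposite \<Rightarrow> 'a opposite \<Rightarrow> 'a opposite" is "(+)" .
lift_definition minus_opposite :: "'a opposite \<Rightarrow> 'a opposite \<Rightarrow> 'a opposite" is "(-)" .
lift_definition uminus_opposite :: "'a opposite \<Rightarrow> 'a opposite" is uminus .
instance by standard (transfer, simp add: algebra_simps)+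
end

instantiation opposite :: (ring_1) ring_1
begin
lift_definition one_opposite :: "'a opposite" is 1 .
lift_definition times_opposite :: "'a opposite \<Rightarrow> 'a opposite \<Rightarrow> 'a opposite" is "\<lambda>x y. y * x" .
instance by standard (transfer, simp add: algebra_simps)+
end

instantiation opposite :: (complex_vector) complex_vector
begin
lift_definition scaleC_opposite :: "complex \<Rightarrow> 'a opposite \<Rightarrow> 'a opposite" is scaleC .
instance
  by standard
    (transfer, simp add: scaleC_add_right scaleC_add_left scaleC_scaleC scaleC_one)+
end

text \<open>Linear maps defined on the space of all linear endomorphisms of \<open>V\<close>, represented as functions
  that are unspecified off that space.\<close>

definition linear_on_endos :: "(('v::complex_vector \<Rightarrow> 'v) \<Rightarrow> 'w::complex_vector) \<Rightarrow> bool" where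
  "linear_on_endos P \<longleftrightarrow> P \<in> extensional {f. clinear f} \<and>
     (\<forall>f g. clinear f \<longrightarrow> clinear g \<longrightarrow> P (\<lambda>x. f x + g x) = P f + P g) \<and>
     (\<forall>c f. clinear f \<longrightarrow> P (\<lambda>x. c *\<^sub>C f x) = c *\<^sub>C P f)"

definition Psi' ::
  "('b::cstar_algebra \<Rightarrow> complex) \<Rightarrow> 'b \<Rightarrow> ('b \<Rightarrow> 'b) \<Rightarrow> ('b, 'b opposite) tensor" where
  "Psi' \<psi> Q = (THE P. linear_on_endos P \<and>
     (\<forall>a c. P (\<lambda>x. \<psi> (a * x) *\<^sub>C c) = c \<otimes>\<^sub>t to_opp (modular Q (- \<i> / 2) a)))"

definition Psi'_0_half ::
  "('b::cstar_algebra \<Rightarrow> 'h::complex_vector) \<Rightarrow> ('h \<Rightarrow> 'h \<Rightarrow> complex) \<Rightarrow> 'b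
    \<Rightarrow> ('h \<Rightarrow> 'h) \<Rightarrow> ('b, 'b opposite) tensor" where
  "Psi'_0_half \<Lambda> ip Q = (THE P. linear_on_endos P \<and>
     (\<forall>a b. P (rank_one ip (\<Lambda> a) (\<Lambda> b)) = b \<otimes>\<^sub>t to_opp (star (modular Q (\<i> / 2) a))))"

end

theory Submission
  imports Defs
begin

text \<open>
  Let \<open>e i\<close> be an orthonormal basis of \<open>B\<close> for the trace, for instance the matrix units, and
  \<open>R = Q\<^sup>-\<^sup>1\<close>. Then \<open>m\<^sup>*(b) = (\<Sum>i. b e i \<otimes> R (e i)\<^sup>*)\<close>, so Schur idempotence of \<open>A\<^sub>0\<close> says
  \<open>A\<^sub>0 b = (\<Sum>i. A\<^sub>0 (b e i) A\<^sub>0 (R (e i)\<^sup>*))\<close>. Since \<open>R = T T\<^sup>*\<close>, the commutation rules of the Casimir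
  element \<open>\<Sum>i. e i \<otimes> (e i)\<^sup>*\<close> turn this, for real \<open>A\<^sub>0\<close>, into
  \<open>A\<^sub>0 (a\<^sup>* b) = (\<Sum>i. A\<^sub>0 (T (e i)\<^sup>* a)\<^sup>* A\<^sub>0 (T (e i)\<^sup>* b))\<close>, which shows complete positivity. Conversely a
  positive map is real. The bending equation makes \<open>A\<^sub>0\<close> its own transpose for the bilinear form
  \<open>(a, b) \<mapsto> \<psi> (a b)\<close>, and then reality is the same as self-adjointness of \<open>A\<close>. The identity
  \<open>\<Psi>'(A\<^sub>0) = \<Psi>'\<^sub>0\<^sub>,\<^sub>1\<^sub>/\<^sub>2(A)\<close> holds on rank-one maps because \<open>(\<sigma>\<^sub>z a)\<^sup>*\<close> is \<open>\<sigma>\<close> with the conjugate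
  parameter applied to \<open>a\<^sup>*\<close>, which needs that \<open>log Q\<close> exists and is unique.
\<close>

section \<open>Linear maps and tensor products\<close>

text \<open>Makes the library facts on linear maps, among them extension from an independent set,
  available for \<open>clinear\<close>.\<close>

interpretation complex_vector_pair: vector_space_pair
  "scaleC :: complex \<Rightarrow> 'a \<Rightarrow> 'a::complex_vector" "scaleC :: complex \<Rightarrow> 'b \<Rightarrow> 'b::complex_vector"
  by unfold_locales

lemma clinear_add: "clinear f \<Longrightarrow> f (x + y) = f x + f y"
  by (rule complex_vector_pair.linear_add)

lemma clinear_scale: "clinear f \<Longrightarrow> f (c *\<^sub>C x) = c *\<^sub>C f x"
  by (rule complex_vector_pair.linear_scale)

lemma clinear_zero: "clinear f \<Longrightarrow> f 0 = 0"
  by (rule complex_vector_pair.linear_0)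

lemma clinear_diff: "clinear f \<Longrightarrow> f (x - y) = f x - f y"
  by (rule complex_vector_pair.linear_diff)

lemma clinear_sum: "clinear f \<Longrightarrow> f (\<Sum>i\<in>I. g i) = (\<Sum>i\<in>I. f (g i))"
  by (rule complex_vector_pair.linear_sum)

lemma clinear_compose: "clinear f \<Longrightarrow> clinear g \<Longrightarrow> clinear (\<lambda>x. g (f x))"
  by (rule clinearI) (simp_all add: clinear_add clinear_scale)

lemma clinear_id: "clinear (\<lambda>x. x)"
  by (rule clinearI) simp_all

lemma clinear_plus: "clinear f \<Longrightarrow> clinear g \<Longrightarrow> clinear (\<lambda>x. f x + g x)"
  by (rule clinearI) (simp_all add: clinear_add clinear_scale scaleC_add_right algebra_simps)

lemma clinear_scaleC: "clinear f \<Longrightarrow> clinear (\<lambda>x. c *\<^sub>C f x)"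
  by (rule clinearI) (simp_all add: clinear_add clinear_scale scaleC_add_right scaleC_scaleC mult.commute)

lemma clinear_coeff: "clinear f \<Longrightarrow> clinear (\<lambda>x. f x *\<^sub>C v)"
  by (rule clinearI) (simp_all add: clinear_add clinear_scale scaleC_add_left scaleC_scaleC scaleC_complex_def)

lemma clinear_sum_fun: "(\<And>i. i \<in> I \<Longrightarrow> clinear (f i)) \<Longrightarrow> clinear (\<lambda>x. \<Sum>i\<in>I. f i x)"
  by (rule complex_vector_pair.linear_compose_sum) auto

section \<open>Bilinear maps and the universal property of the tensor product\<close>

lemma cbilinearI:
  assumes "\<And>x. clinear (\<beta> x)" and "\<And>y. clinear (\<lambda>x. \<beta> x y)"
  shows "cbilinear \<beta>"
  using assms by (simp add: cbilinear_def)

lemma cbilinearD: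
  assumes "cbilinear \<beta>"
  shows "clinear (\<beta> x)" "clinear (\<lambda>x. \<beta> x y)"
  using assms by (simp_all add: cbilinear_def)

text \<open>A single nonzero vector is independent, so a functional with value 1 on it extends to
  the whole space.\<close>

lemma ex_functional_nonzero:
  fixes x :: "'a::complex_vector"
  assumes "x \<noteq> 0"
  obtains f :: "'a \<Rightarrow> complex" where "clinear f" "f x \<noteq> 0"
proof -
  have "complex_vector.independent {x}"
    using assms by (simp add: complex_vector.dependent_single)
  from complex_vector_pair.linear_independent_extend[OF this, of "\<lambda>_. 1 :: complex"]
  obtain g :: "'a \<Rightarrow> complex" where "clinear g" "g x = 1" by auto
  then show thesis using that by auto
qed

text \<open>\<open>tensor_rel\<close> tests complex-valued forms only. If a vector-valued map told
  \<open>xs\<close> and \<open>ys\<close> apart, composing it with a functional that is nonzero on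
  the difference would give a form that does so too.\<close>

lemma tensor_rel_sum:
  fixes \<beta> :: "'a::complex_vector \<Rightarrow> 'b::complex_vector \<Rightarrow> 'c::complex_vector"
  assumes bil: "cbilinear \<beta>" and rel: "tensor_rel xs ys"
  shows "(\<Sum>(a, b)\<leftarrow>xs. \<beta> a b) = (\<Sum>(a, b)\<leftarrow>ys. \<beta> a b)"
proof (rule ccontr)
  assume "\<not> ?thesis"
  then have "(\<Sum>(a, b)\<leftarrow>xs. \<beta> a b) - (\<Sum>(a, b)\<leftarrow>ys. \<beta> a b) \<noteq> 0" by simp
  then obtain f :: "'c \<Rightarrow> complex" where f: "clinear f"
    and neq: "f ((\<Sum>(a, b)\<leftarrow>xs. \<beta> a b) - (\<Sum>(a, b)\<leftarrow>ys. \<beta> a b)) \<noteq> 0"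
    by (rule ex_functional_nonzero)
  have "cbilinear (\<lambda>a b. f (\<beta> a b))"
    by (intro cbilinearI clinear_compose[OF _ f] cbilinearD[OF bil])
  then have "eval_pairs (\<lambda>a b. f (\<beta> a b)) xs = eval_pairs (\<lambda>a b. f (\<beta> a b)) ys"
    using rel by (simp add: tensor_rel_def)
  moreover have "eval_pairs (\<lambda>a b. f (\<beta> a b)) zs = f (\<Sum>(a, b)\<leftarrow>zs. \<beta> a b)" for zs
    by (induction zs) (auto simp: eval_pairs_def clinear_add[OF f] clinear_zero[OF f])
  ultimately show False using neq by (simp add: clinear_diff[OF f])
qed

text \<open>Every tensor is represented by a list, and a list is the sum of its one-element lists;
  so addition alone generates everything from the elementary tensors.\<close>

lemma tensor_induct [case_names zero elem add]:
  assumes zero: "P 0" and elem: "\<And>a b. P (a \<otimes>\<^sub>t b)" and add: "\<And>s t. P s \<Longrightarrow> P t \<Longrightarrow> P (s + t)"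
  shows "P t"
proof -
  have "P (abs_tensor xs)" for xs
  proof (induction xs)
    case Nil
    then show ?case using zero by (simp add: zero_tensor_def)
  next
    case (Cons x xs)
    obtain a b where x: "x = (a, b)" by force
    have "abs_tensor (x # xs) = a \<otimes>\<^sub>t b + abs_tensor xs"
      by (simp add: x elem_tensor.abs_eq plus_tensor.abs_eq)
    then show ?case using elem add Cons by simp
  qed
  from this[of "rep_tensor t"] show ?thesis
    using Quotient3_abs_rep[OF Quotient3_tensor, of t] by simp
qed

lemma clinear_tensor_eqI:
  assumes f: "clinear f" and g: "clinear g" and eq: "\<And>a b. f (a \<otimes>\<^sub>t b) = g (a \<otimes>\<^sub>t b)"
  shows "f t = g t"
  by (induction t rule: tensor_induct)
    (simp_all add: eq clinear_zero[OF f] clinear_zero[OF g] clinear_add[OF f] clinear_add[OF g])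

lemma elem_tensor_bilinear:
  "cbilinear (\<lambda>(a::'a::complex_vector) (b::'b::complex_vector). a \<otimes>\<^sub>t b)"
proof (intro cbilinearI clinearI)
  fix x y :: 'a and u v :: 'b and c
  note eval = tensor_rel_def eval_pairs_def cbilinear_simps scaleC_complex_def
  show "x \<otimes>\<^sub>t (u + v) = x \<otimes>\<^sub>t u + x \<otimes>\<^sub>t v" by transfer (simp add: eval)
  show "x \<otimes>\<^sub>t (c *\<^sub>C v) = c *\<^sub>C (x \<otimes>\<^sub>t v)" by transfer (simp add: eval)
  show "(x + y) \<otimes>\<^sub>t v = x \<otimes>\<^sub>t v + y \<otimes>\<^sub>t v" by transfer (simp add: eval)
  show "(c *\<^sub>C x) \<otimes>\<^sub>t v = c *\<^sub>C (x \<otimes>\<^sub>t v)" by transfer (simp add: eval)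
qed

text \<open>Justifies the definite description: summing \<open>\<beta>\<close> over a representing
  list is well defined by \<open>tensor_rel_sum\<close>, and a linear map is determined by its
  values on elementary tensors.\<close>

lemma tensor_lift:
  fixes \<beta> :: "'a::complex_vector \<Rightarrow> 'b::complex_vector \<Rightarrow> 'c::complex_vector"
  assumes bil: "cbilinear \<beta>"
  shows clinear_tensor_lift: "clinear (tensor_lift \<beta>)"
    and tensor_lift_elem: "tensor_lift \<beta> (a \<otimes>\<^sub>t b) = \<beta> a b"
proof -
  define L where "L xs = (\<Sum>(a, b)\<leftarrow>xs. \<beta> a b)" for xs
  define h where "h t = L (rep_tensor t)" for t
  have h_abs: "h (abs_tensor xs) = L xs" for xs
    unfolding h_def L_def
    by (rule tensor_rel_sum[OF bil]) (rule rep_abs_rsp_left[OF Quotient3_tensor], simp add: tensor_rel_def)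
  have abs_surj: "\<exists>xs. t = abs_tensor xs" for t :: "('a, 'b) tensor"
    using Quotient3_abs_rep[OF Quotient3_tensor, of t] by metis
  have lin: "clinear h"
  proof (rule clinearI)
    fix s t :: "('a, 'b) tensor" and c
    obtain xs ys where st: "s = abs_tensor xs" "t = abs_tensor ys" using abs_surj by metis
    show "h (s + t) = h s + h t"
      by (simp add: st plus_tensor.abs_eq h_abs) (simp add: L_def)
    have "L (map (\<lambda>(a, b). (c *\<^sub>C a, b)) xs) = c *\<^sub>C L xs"
      by (induction xs) (auto simp: L_def cbilinear_simps[OF bil] scaleC_add_right)
    then show "h (c *\<^sub>C s) = c *\<^sub>C h s"
      by (simp add: st scaleC_tensor.abs_eq h_abs)
  qed
  have elem: "h (a \<otimes>\<^sub>t b) = \<beta> a b" for a b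
    by (simp add: elem_tensor.abs_eq h_abs) (simp add: L_def)
  have "\<exists>!h. clinear h \<and> (\<forall>a b. h (a \<otimes>\<^sub>t b) = \<beta> a b)"
  proof (rule ex1I[of _ h])
    show "h' = h" if "clinear h' \<and> (\<forall>a b. h' (a \<otimes>\<^sub>t b) = \<beta> a b)" for h'
      using that by - (rule ext, rule clinear_tensor_eqI[OF _ lin], simp_all add: elem)
  qed (simp add: lin elem)
  from theI'[OF this] show "clinear (tensor_lift \<beta>)" "tensor_lift \<beta> (a \<otimes>\<^sub>t b) = \<beta> a b"
    by (auto simp: tensor_lift_def)
qed

lemma cbilinear_tensor_map:
  assumes "clinear f" "clinear g"
  shows "cbilinear (\<lambda>a b. f a \<otimes>\<^sub>t g b)"
proof (rule cbilinearI)
  show "clinear (\<lambda>b. f a \<otimes>\<^sub>t g b)" for a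
    by (rule clinear_compose[OF assms(2) cbilinearD(1)[OF elem_tensor_bilinear]])
  show "clinear (\<lambda>a. f a \<otimes>\<^sub>t g b)" for b
    by (rule clinear_compose[OF assms(1) cbilinearD(2)[OF elem_tensor_bilinear]])
qed

lemma tensor_map:
  assumes "clinear f" "clinear g"
  shows clinear_tensor_map: "clinear (tensor_map f g)"
    and tensor_map_elem: "tensor_map f g (a \<otimes>\<^sub>t b) = f a \<otimes>\<^sub>t g b"
  unfolding tensor_map_def
  by (rule tensor_lift cbilinear_tensor_map assms)+

text \<open>The universal property is applied twice: to the two left factors with \<open>c\<close>
  fixed, then to the outer product, where linearity in \<open>c\<close> is checked on elementary
  tensors.\<close>

lemma tensor_assoc:
  shows clinear_tensor_assoc: "clinear (tensor_assoc ::
      (('a::complex_vector, 'b::complex_vector) tensor, 'c::complex_vector) tensor \<Rightarrow> _)"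
    and tensor_assoc_elem: "tensor_assoc ((x \<otimes>\<^sub>t y) \<otimes>\<^sub>t (z::'c)) = (x::'a) \<otimes>\<^sub>t (y::'b) \<otimes>\<^sub>t z"
proof -
  note el = cbilinearD[OF elem_tensor_bilinear]
  have inner: "cbilinear (\<lambda>(a::'a) (b::'b). a \<otimes>\<^sub>t b \<otimes>\<^sub>t (c::'c))" for c
  proof (rule cbilinearI)
    show "clinear (\<lambda>b. a \<otimes>\<^sub>t b \<otimes>\<^sub>t c)" for a :: 'a
      by (rule clinear_compose[OF el(2) el(1)])
  qed (rule el(2))
  define T where "T c = tensor_lift (\<lambda>(a::'a) (b::'b). a \<otimes>\<^sub>t b \<otimes>\<^sub>t (c::'c))" for c
  note T = tensor_lift[OF inner, folded T_def]
  have outer: "cbilinear (\<lambda>s c. T c s)"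
  proof (intro cbilinearI T(1) clinearI)
    fix s :: "('a, 'b) tensor" and c d :: 'c and k
    show "T (c + d) s = T c s + T d s"
      by (rule clinear_tensor_eqI[of _ "\<lambda>s. T c s + T d s"])
        (simp_all add: T clinear_plus cbilinear_simps[OF elem_tensor_bilinear])
    show "T (k *\<^sub>C c) s = k *\<^sub>C T c s"
      by (rule clinear_tensor_eqI[of _ "\<lambda>s. k *\<^sub>C T c s"])
        (simp_all add: T clinear_scaleC cbilinear_simps[OF elem_tensor_bilinear])
  qed
  have assoc: "tensor_assoc = tensor_lift (\<lambda>s c. T c s)"
    by (simp add: tensor_assoc_def T_def)
  show "clinear (tensor_assoc :: (('a, 'b) tensor, 'c) tensor \<Rightarrow> _)"
    unfolding assoc by (rule tensor_lift[OF outer])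
  show "tensor_assoc ((x \<otimes>\<^sub>t y) \<otimes>\<^sub>t z) = x \<otimes>\<^sub>t y \<otimes>\<^sub>t z"
    by (simp add: assoc tensor_lift_elem[OF outer] T)
qed

section \<open>Sesquilinear forms and Hilbert space adjoints\<close>

lemma scaleC_complex [simp]: "c *\<^sub>C z = c * (z :: complex)"
  by (simp add: scaleC_complex_def)

text \<open>Conjugate linearity on the left is put as linearity of the conjugate, so that the facts
  on \<open>clinear\<close> and \<open>tensor_lift\<close> apply to both slots.\<close>

definition sesquilinear :: "('a::complex_vector \<Rightarrow> 'a \<Rightarrow> complex) \<Rightarrow> bool" where
  "sesquilinear S \<longleftrightarrow> (\<forall>x. clinear (S x)) \<and> (\<forall>y. clinear (\<lambda>x. cnj (S x y)))"

lemma sesquilinearD: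
  assumes "sesquilinear S"
  shows "clinear (S x)" "clinear (\<lambda>x. cnj (S x y))"
  using assms by (simp_all add: sesquilinear_def)

lemma cnj_clinear:
  assumes "clinear (\<lambda>x. cnj (S x))"
  shows "S (x + y) = S x + S y" "S (c *\<^sub>C x) = cnj c * S x" "S (x - y) = S x - S y" "S 0 = 0"
  using arg_cong[OF clinear_add[OF assms, of x y], of cnj] arg_cong[OF clinear_scale[OF assms, of c x], of cnj]
    arg_cong[OF clinear_diff[OF assms, of x y], of cnj] arg_cong[OF clinear_zero[OF assms], of cnj]
  by simp_all

lemma sesquilinear_simps:
  assumes "sesquilinear S"
  shows "S (x + x') y = S x y + S x' y" "S (c *\<^sub>C x) y = cnj c * S x y"
    and "S (x - x') y = S x y - S x' y" "S 0 y = 0"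
    and "S x (y + y') = S x y + S x y'" "S x (c *\<^sub>C y) = c * S x y"
    and "S x (y - y') = S x y - S x y'" "S x 0 = 0"
proof -
  note r = sesquilinearD(1)[OF assms] and l = sesquilinearD(2)[OF assms]
  show "S (x + x') y = S x y + S x' y" "S (c *\<^sub>C x) y = cnj c * S x y"
    "S (x - x') y = S x y - S x' y" "S 0 y = 0"
    by (rule cnj_clinear[OF l])+
  show "S x (y + y') = S x y + S x y'" "S x (c *\<^sub>C y) = c * S x y"
    "S x (y - y') = S x y - S x y'" "S x 0 = 0"
    using clinear_scale[OF r] by (simp_all add: clinear_add[OF r] clinear_diff[OF r] clinear_zero[OF r])
qed

text \<open>The form is lifted one slot at a time. For fixed \<open>c\<close> and \<open>d\<close>
  the conjugated form is bilinear in \<open>a\<close> and \<open>b\<close> and lifts to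
  \<open>L c d\<close>; conjugating back gives a map bilinear in \<open>c\<close> and
  \<open>d\<close>, which lifts to the right slot.\<close>

lemma tensor_ip:
  fixes ipV :: "'a::complex_vector \<Rightarrow> 'a \<Rightarrow> complex" and ipW :: "'b::complex_vector \<Rightarrow> 'b \<Rightarrow> complex"
  assumes V: "sesquilinear ipV" and W: "sesquilinear ipW"
  shows sesquilinear_tensor_ip: "sesquilinear (tensor_ip ipV ipW)"
    and tensor_ip_elem: "tensor_ip ipV ipW (a \<otimes>\<^sub>t b) (c \<otimes>\<^sub>t d) = ipV a c * ipW b d"
proof -
  note simps = sesquilinear_simps[OF V] sesquilinear_simps[OF W]
  define L where "L c d = tensor_lift (\<lambda>a b. cnj (ipV a c * ipW b d))" for c d
  have L: "cbilinear (\<lambda>a b. cnj (ipV a c * ipW b d))" for c d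
    by (rule cbilinearI; rule clinearI) (simp_all add: simps algebra_simps)
  note L_lin = clinear_tensor_lift[OF L, folded L_def] and L_elem = tensor_lift_elem[OF L, folded L_def]
  have L_add1: "L (c + c') d s = L c d s + L c' d s" for c c' d s
    by (rule clinear_tensor_eqI[of _ "\<lambda>s. L c d s + L c' d s"])
      (simp_all add: L_lin clinear_plus L_elem simps algebra_simps)
  have L_add2: "L c (d + d') s = L c d s + L c d' s" for c d d' s
    by (rule clinear_tensor_eqI[of _ "\<lambda>s. L c d s + L c d' s"])
      (simp_all add: L_lin clinear_plus L_elem simps algebra_simps)
  have L_scale1: "L (k *\<^sub>C c) d s = cnj k *\<^sub>C L c d s" for c d s k
    by (rule clinear_tensor_eqI[of _ "\<lambda>s. cnj k *\<^sub>C L c d s", OF L_lin clinear_scaleC[OF L_lin]])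
      (simp add: L_elem simps)
  have L_scale2: "L c (k *\<^sub>C d) s = cnj k *\<^sub>C L c d s" for c d s k
    by (rule clinear_tensor_eqI[of _ "\<lambda>s. cnj k *\<^sub>C L c d s", OF L_lin clinear_scaleC[OF L_lin]])
      (simp add: L_elem simps)
  define S where "S s = tensor_lift (\<lambda>c d. cnj (L c d s))" for s
  have S: "cbilinear (\<lambda>c d. cnj (L c d s))" for s
    by (rule cbilinearI; rule clinearI) (simp_all add: L_add1 L_add2 L_scale1 L_scale2)
  note S_lin = clinear_tensor_lift[OF S, folded S_def] and S_elem = tensor_lift_elem[OF S, folded S_def]
  have S_add: "S (s + s') t = S s t + S s' t" for s s' t
    by (rule clinear_tensor_eqI[of _ "\<lambda>t. S s t + S s' t", OF S_lin clinear_plus[OF S_lin S_lin]])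
      (simp add: S_elem clinear_add[OF L_lin])
  have S_scale: "S (k *\<^sub>C s) t = cnj k *\<^sub>C S s t" for s t k
    by (rule clinear_tensor_eqI[of _ "\<lambda>t. cnj k *\<^sub>C S s t", OF S_lin clinear_scaleC[OF S_lin]])
      (simp add: S_elem clinear_scale[OF L_lin])
  define P where "P S \<longleftrightarrow> (\<forall>s. clinear (S s)) \<and> (\<forall>t. clinear (\<lambda>s. cnj (S s t))) \<and>
     (\<forall>a b c d. S (a \<otimes>\<^sub>t b) (c \<otimes>\<^sub>t d) = ipV a c * ipW b d)" for S
  have "clinear (\<lambda>s. cnj (S s t))" for t
    by (rule clinearI) (simp_all add: S_add S_scale)
  then have PS: "P S" by (simp add: P_def S_lin S_elem L_elem)
  have uniq: "S' = S" if S': "P S'" for S'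
  proof (intro ext)
    fix s t
    show "S' s t = S s t"
    proof (rule clinear_tensor_eqI[of "S' s"])
      show "clinear (S' s)" using S' by (simp add: P_def)
      fix c d
      have "cnj (S' s (c \<otimes>\<^sub>t d)) = cnj (S s (c \<otimes>\<^sub>t d))"
        by (rule clinear_tensor_eqI[of "\<lambda>s. cnj (S' s (c \<otimes>\<^sub>t d))" "\<lambda>s. cnj (S s (c \<otimes>\<^sub>t d))"])
          (use S' PS in \<open>simp_all add: P_def\<close>)
      then show "S' s (c \<otimes>\<^sub>t d) = S s (c \<otimes>\<^sub>t d)" by simp
    qed (rule S_lin)
  qed
  have "tensor_ip ipV ipW = S"
    unfolding tensor_ip_def P_def[symmetric] using PS uniq by (rule the_equality)
  then show "sesquilinear (tensor_ip ipV ipW)"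
    "tensor_ip ipV ipW (a \<otimes>\<^sub>t b) (c \<otimes>\<^sub>t d) = ipV a c * ipW b d"
    using PS by (simp_all add: P_def sesquilinear_def)
qed

text \<open>The values of two candidates differ by a vector orthogonal to everything, which is zero
  by nondegeneracy.\<close>

lemma hilbert_adj_eqI:
  assumes ip: "sesquilinear ipV" and nondeg: "\<And>t. (\<And>v. ipV t v = 0) \<Longrightarrow> t = 0"
    and g: "clinear g" and adj: "\<And>v w. ipW w (f v) = ipV (g w) v"
  shows "hilbert_adj ipV ipW f = g"
  unfolding hilbert_adj_def
proof (rule the_equality)
  fix g' assume g': "clinear g' \<and> (\<forall>v w. ipW w (f v) = ipV (g' w) v)"
  show "g' = g"
  proof
    fix w
    have "ipV (g' w - g w) v = 0" for v
      using g' adj[of w v] by (simp add: sesquilinear_simps[OF ip])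
    then show "g' w = g w" using nondeg[of "g' w - g w"] by simp
  qed
qed (simp add: g adj)

section \<open>Schur square and bending for an explicit comultiplication\<close>

lemma schur_square_eq:
  assumes "clinear m" "clinear f" and ms: "ms b = (\<Sum>i\<in>I. x i \<otimes>\<^sub>t y i)"
  shows "schur_square m ms f b = (\<Sum>i\<in>I. m (f (x i) \<otimes>\<^sub>t f (y i)))"
  by (simp add: schur_square_def ms clinear_sum[OF clinear_tensor_map] tensor_map_elem clinear_sum[OF assms(1)] assms(2))

text \<open>The first leg of \<open>ms (u 1)\<close> survives as a vector, while the second passes
  through \<open>f\<close>, is multiplied with \<open>v\<close> and becomes a scalar under
  \<open>e\<close>.\<close>

lemma bend_eq:
  fixes m :: "('v::complex_vector, 'v) tensor \<Rightarrow> 'v"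
  assumes m: "clinear m" and ms: "clinear ms" and u: "clinear u" and e: "clinear e" and f: "clinear f"
    and ms1: "ms (u 1) = (\<Sum>i\<in>I. x i \<otimes>\<^sub>t y i)"
  shows "bend m ms u e f v = (\<Sum>i\<in>I. e (m (f (y i) \<otimes>\<^sub>t v)) *\<^sub>C x i)"
proof -
  note idl = clinear_id[folded id_def]
  have msu: "clinear (ms \<circ> u)" using clinear_compose[OF u ms] by (simp add: o_def)
  have em: "clinear (e \<circ> m)" using clinear_compose[OF m e] by (simp add: o_def)
  have fid: "clinear (tensor_map f (id :: 'v \<Rightarrow> 'v))" by (rule clinear_tensor_map[OF f idl])
  have sc: "cbilinear (\<lambda>(v :: 'v) c. c *\<^sub>C v)"
    by (rule cbilinearI; rule clinearI)
      (simp_all add: scaleC_add_left scaleC_add_right scaleC_scaleC mult.commute)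
  have "(\<Sum>i\<in>I. x i \<otimes>\<^sub>t y i) \<otimes>\<^sub>t v = (\<Sum>i\<in>I. (x i \<otimes>\<^sub>t y i) \<otimes>\<^sub>t v)"
    by (rule clinear_sum[OF cbilinearD(2)[OF elem_tensor_bilinear]])
  then have "tensor_map (ms \<circ> u) id (1 \<otimes>\<^sub>t v) = (\<Sum>i\<in>I. (x i \<otimes>\<^sub>t y i) \<otimes>\<^sub>t v)"
    by (simp add: tensor_map_elem[OF msu idl] ms1)
  then show ?thesis
    by (simp add: bend_def clinear_sum[OF clinear_tensor_assoc] tensor_assoc_elem
        clinear_sum[OF clinear_tensor_map[OF idl fid]] tensor_map_elem[OF idl fid] tensor_map_elem[OF f idl]
        clinear_sum[OF clinear_tensor_map[OF idl em]] tensor_map_elem[OF idl em]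
        clinear_sum[OF clinear_tensor_lift[OF sc]] tensor_lift_elem[OF sc])
qed

section \<open>Linear maps on spaces of endomorphisms\<close>

lemma linear_on_endos_sum:
  assumes P: "linear_on_endos P" and I: "finite I" and g: "\<And>i. i \<in> I \<Longrightarrow> clinear (g i)"
  shows "P (\<lambda>x. \<Sum>i\<in>I. g i x) = (\<Sum>i\<in>I. P (g i))"
  using I g
proof induction
  case empty
  \<comment> \<open>The empty sum is the zero map, whose image is found from homogeneity with scalar
    \<open>0\<close>.\<close>
  have "P (\<lambda>x. 0 *\<^sub>C x) = 0 *\<^sub>C P (\<lambda>x. x)"
    using P clinear_id unfolding linear_on_endos_def by blast
  then show ?case by simp
next
  case (insert i I)
  have "P (\<lambda>x. g i x + (\<Sum>i\<in>I. g i x)) = P (g i) + P (\<lambda>x. \<Sum>i\<in>I. g i x)"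
    using P insert.prems clinear_sum_fun[of I g] unfolding linear_on_endos_def by simp
  then show ?case using insert by simp
qed

text \<open>A frame \<open>x = (\<Sum>i. \<phi> i x e i)\<close> writes each endomorphism as a sum of the rank-one maps
  \<open>x \<mapsto> \<phi> i x c\<close>.\<close>

lemma linear_on_endos_eqI:
  assumes P: "linear_on_endos P" and P': "linear_on_endos P'"
    and I: "finite I" and \<phi>: "\<And>i. clinear (\<phi> i)" and frame: "\<And>x. x = (\<Sum>i\<in>I. \<phi> i x *\<^sub>C e i)"
    and eq: "\<And>i c. P (\<lambda>x. \<phi> i x *\<^sub>C c) = P' (\<lambda>x. \<phi> i x *\<^sub>C c)"
  shows "P = P'"
proof
  fix f
  show "P f = P' f"
  proof (cases "clinear f")
    case False
    then show ?thesis using P P' by (simp add: linear_on_endos_def extensional_def)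
  next
    case f: True
    have f_eq: "f = (\<lambda>x. \<Sum>i\<in>I. \<phi> i x *\<^sub>C f (e i))"
    proof
      fix x
      show "f x = (\<Sum>i\<in>I. \<phi> i x *\<^sub>C f (e i))"
        by (subst frame) (simp only: clinear_sum[OF f] clinear_scale[OF f])
    qed
    have "P f = (\<Sum>i\<in>I. P (\<lambda>x. \<phi> i x *\<^sub>C f (e i)))"
      by (subst f_eq, rule linear_on_endos_sum[OF P I clinear_coeff[OF \<phi>]])
    also have "\<dots> = (\<Sum>i\<in>I. P' (\<lambda>x. \<phi> i x *\<^sub>C f (e i)))" by (simp only: eq)
    also have "\<dots> = P' (\<lambda>x. \<Sum>i\<in>I. \<phi> i x *\<^sub>C f (e i))"
      by (rule linear_on_endos_sum[OF P' I clinear_coeff[OF \<phi>], symmetric])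
    finally show ?thesis by (simp flip: f_eq)
  qed
qed

text \<open>Supplies the candidates for \<open>Psi'\<close> and \<open>Psi'_0_half\<close>, given by
  evaluation at frame vectors. \<open>restrict\<close> produces the unspecified value that
  \<open>linear_on_endos\<close> prescribes off the linear maps.\<close>

lemma linear_on_endos_frame:
  assumes g: "clinear g"
  shows "linear_on_endos (restrict (\<lambda>f. \<Sum>i\<in>I. g (f (e i)) \<otimes>\<^sub>t w i) {f. clinear f})"
  by (auto simp: linear_on_endos_def clinear_plus clinear_scaleC clinear_add[OF g] clinear_scale[OF g]
      cbilinear_simps[OF elem_tensor_bilinear] sum.distrib complex_vector.scale_sum_right)

lemma clinear_to_opp: "clinear (to_opp :: 'a::complex_vector \<Rightarrow> 'a opposite)"
  by (rule clinearI) (transfer, simp)+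

section \<open>Spectral decomposition and logarithms\<close>

lemma star_zero [simp]: "star (0 :: 'a::cstar_algebra) = 0"
  using star_add[of 0 "0 :: 'a"] by simp

lemma star_minus: "star (- x :: 'a::cstar_algebra) = - star x"
  using star_add[of x "- x"] by (simp add: eq_neg_iff_add_eq_0 add.commute)

lemma star_diff: "star (x - y :: 'a::cstar_algebra) = star x - star y"
  using star_add[of x "- y"] by (simp add: star_minus)

lemma star_sum: "star (\<Sum>i\<in>I. f i :: 'a::cstar_algebra) = (\<Sum>i\<in>I. star (f i))"
  by (induction I rule: infinite_finite_induct) (simp_all add: star_add)

lemma star_one [simp]: "star (1 :: 'a::cstar_algebra) = 1"
  using star_mult[of "star 1" "1 :: 'a"] by (simp add: star_star)

lemma star_scaleR: "star (r *\<^sub>R x :: 'a::cstar_algebra) = r *\<^sub>R star x"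
  by (simp add: scaleR_scaleC star_scaleC)

lemma star_mult_self_eq_0: "star x * x = 0 \<longleftrightarrow> x = (0 :: 'a::cstar_algebra)"
  using norm_star_mult[of x] by auto

text \<open>The C*-identity and submultiplicativity give one inequality, and replacing
  \<open>x\<close> by \<open>star x\<close> gives the other. This bounds \<open>star\<close>, so
  that \<open>star_exp\<close> can apply it termwise to a series.\<close>

lemma norm_star: "norm (star x) = norm (x :: 'a::cstar_algebra)"
proof -
  have le: "norm y \<le> norm (star y)" for y :: 'a
  proof (cases "y = 0")
    case False
    have "norm y * norm y \<le> norm (star y) * norm y"
      using norm_mult_ineq[of "star y" y] by (simp add: norm_star_mult power2_eq_square)
    then show ?thesis using False by simp
  qed simp
  show ?thesis using le[of x] le[of "star x"] by (simp add: star_star)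
qed

lemma clinear_mult_left: "clinear (\<lambda>x. a * x :: 'a::cstar_algebra)"
  by (rule clinearI) (simp_all add: distrib_left scaleC_mult_right)

lemma clinear_mult_right: "clinear (\<lambda>x. x * a :: 'a::cstar_algebra)"
  by (rule clinearI) (simp_all add: distrib_right scaleC_mult_left)

lemma star_exp: "star (exp x) = exp (star x :: 'a::cstar_algebra)"
proof -
  have pow: "star (x ^ n) = star x ^ n" for n
    by (induction n) (simp_all add: star_mult power_commutes)
  have "bounded_linear (star :: 'a \<Rightarrow> 'a)"
    by (rule bounded_linear_intro[where K = 1]) (simp_all add: star_add star_scaleR norm_star)
  from bounded_linear.sums[OF this exp_converges[of x]]
  have "(\<lambda>n. star x ^ n /\<^sub>R fact n) sums star (exp x)"
    by (simp add: star_scaleR pow)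
  then show ?thesis using exp_converges[of "star x"] sums_unique2 by blast
qed

text \<open>Each power of \<open>h\<close> acts on \<open>p\<close> as the same power of
  \<open>c\<close>, hence so does the exponential series.\<close>

lemma exp_mult_eigenvector:
  fixes h p :: "'a::{real_normed_algebra_1, banach}"
  assumes "h * p = c *\<^sub>R p"
  shows "exp h * p = exp c *\<^sub>R p"
proof -
  have pow: "h ^ n * p = c ^ n *\<^sub>R p" for n
    by (induction n) (simp_all add: mult.assoc assms power_commutes flip: power_Suc2)
  have "(\<lambda>n. (h ^ n /\<^sub>R fact n) * p) sums (exp h * p)"
    by (rule sums_mult2[OF exp_converges])
  moreover have "(\<lambda>n. (c ^ n /\<^sub>R fact n) *\<^sub>R p) sums (exp c *\<^sub>R p)"
    by (rule sums_scaleR_left[OF exp_converges])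
  ultimately show ?thesis
    by (simp add: pow sums_unique2)
qed

section \<open>Polynomials in an element and eigenvectors of left multiplication\<close>

definition poly_at :: "'a::cstar_algebra \<Rightarrow> complex poly \<Rightarrow> 'a" where
  "poly_at x p = fold_coeffs (\<lambda>a s. a *\<^sub>C 1 + x * s) p 0"

lemma poly_at_0 [simp]: "poly_at x 0 = 0"
  by (simp add: poly_at_def)

lemma poly_at_pCons [simp]: "poly_at x (pCons a p) = a *\<^sub>C 1 + x * poly_at x p"
  by (cases "p = 0 \<and> a = 0") (auto simp: poly_at_def)

lemma poly_at_add: "poly_at x (p + q) = poly_at x p + poly_at x q"
  by (induction p q rule: poly_induct2) (simp_all add: scaleC_add_left algebra_simps)

lemma poly_at_smult: "poly_at x (Polynomial.smult c p) = c *\<^sub>C poly_at x p"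
  by (induction p) (simp_all add: scaleC_add_right scaleC_scaleC scaleC_mult_right)

lemma poly_at_commute: "x * poly_at x p = poly_at x p * x"
proof (induction p)
  case (pCons a p)
  have "x * (x * poly_at x p) = x * (poly_at x p * x)"
    by (simp only: pCons.IH)
  then show ?case
    by (simp add: distrib_left distrib_right scaleC_mult_left scaleC_mult_right mult.assoc)
qed simp

lemma poly_at_monom: "poly_at x (monom c n) = c *\<^sub>C x ^ n"
  by (induction n) (simp_all add: monom_0 monom_Suc scaleC_mult_right)

lemma poly_at_sum: "poly_at x (\<Sum>i\<in>I. p i) = (\<Sum>i\<in>I. poly_at x (p i))"
  by (induction I rule: infinite_finite_induct) (simp_all add: poly_at_add)

text \<open>The powers of \<open>x\<close> up to exponent \<open>N\<close>, the size of a spanning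
  set, are too many to be independent. Coinciding powers form a separate case because dependence is
  a property of the set of powers.\<close>

lemma ex_annihilating_poly:
  fixes x :: "'a::fd_cstar_algebra"
  obtains p where "p \<noteq> 0" "poly_at x p = 0"
proof -
  obtain S :: "'a set" where S: "finite S" "\<And>x. \<exists>c. x = (\<Sum>s\<in>S. c s *\<^sub>C s)"
    using finite_dimensional by blast
  define N where "N = card S"
  define T where "T = (\<lambda>i. x ^ i) ` {..N}"
  have span: "T \<subseteq> complex_vector.span S"
  proof
    fix t assume "t \<in> T"
    obtain c where "t = (\<Sum>s\<in>S. c s *\<^sub>C s)" using S(2) by blast
    then show "t \<in> complex_vector.span S"
      using complex_vector.span_sum[of S "\<lambda>s. c s *\<^sub>C s" S]
      by (simp add: complex_vector.span_scale complex_vector.span_base)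
  qed
  show thesis
  proof (cases "inj_on (\<lambda>i. x ^ i) {..N}")
    case False
    then obtain i j where ij: "i \<noteq> j" "x ^ i = x ^ j" by (auto simp: inj_on_def)
    show thesis
    proof (rule that)
      have "coeff (monom 1 i + monom (- 1 :: complex) j) i \<noteq> 0" using ij by simp
      then show "monom 1 i + monom (- 1 :: complex) j \<noteq> 0" by force
      show "poly_at x (monom 1 i + monom (- 1) j) = 0"
        using ij by (simp add: poly_at_add poly_at_monom)
    qed
  next
    case inj: True
    then have "card T = Suc N" by (simp add: T_def card_image)
    then have "complex_vector.dependent T"
      using complex_vector.independent_span_bound[OF S(1) _ span] by (auto simp: N_def)
    then obtain u v where u: "v \<in> T" "u v \<noteq> 0" "(\<Sum>v\<in>T. u v *\<^sub>C v) = 0"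
      by (subst (asm) complex_vector.dependent_finite) (auto simp: T_def)
    then obtain j where j: "j \<le> N" "v = x ^ j" by (auto simp: T_def)
    show thesis
    proof (rule that)
      have "coeff (\<Sum>i\<le>N. monom (u (x ^ i)) i) j = u (x ^ j)"
        using j by (simp add: coeff_sum)
      then show "(\<Sum>i\<le>N. monom (u (x ^ i)) i) \<noteq> 0"
        using u(2) j(2) by force
      show "poly_at x (\<Sum>i\<le>N. monom (u (x ^ i)) i) = 0"
        using u(3) inj by (simp add: poly_at_sum poly_at_monom T_def sum.reindex)
    qed
  qed
qed

text \<open>The fundamental theorem of algebra gives a root \<open>l\<close> of \<open>p\<close>.
  Its factor commutes with the others and can act on \<open>v\<close> first; the induction treats
  the quotient. The list \<open>ls\<close> collects the roots.\<close>

lemma ex_annihilating_factors: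
  fixes x v :: "'a::cstar_algebra"
  assumes "p \<noteq> 0" "poly_at x p * v = 0"
  shows "\<exists>ls. foldl (\<lambda>v l. x * v - l *\<^sub>C v) v ls = 0"
  using assms
proof (induction "degree p" arbitrary: p v)
  case 0
  then obtain c where "p = [:c:]" "c \<noteq> 0" by (metis degree_eq_zeroE pCons_0_0)
  with 0 have "v = 0" by (auto simp: scaleC_mult_left)
  then show ?case by (intro exI[of _ "[]"]) simp
next
  case (Suc n)
  then obtain l where "poly p l = 0"
    by (metis constant_degree fundamental_theorem_of_algebra nat.distinct(1))
  then obtain q where p: "p = [:- l, 1:] * q" by (metis dvdE poly_eq_0_iff_dvd)
  then have "q \<noteq> 0" using Suc.prems by auto
  moreover from this have "degree p = Suc (degree q)"
    unfolding p by (subst degree_mult_eq) auto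
  ultimately have q: "q \<noteq> 0" "degree q = n" using Suc.hyps by simp_all
  have "p = pCons 0 q + Polynomial.smult (- l) q" by (simp add: p)
  then have "poly_at x p = x * poly_at x q - l *\<^sub>C poly_at x q"
    by (simp only: poly_at_add poly_at_smult poly_at_pCons) simp
  also have "\<dots> * v = poly_at x q * x * v - l *\<^sub>C (poly_at x q * v)"
    by (simp only: poly_at_commute left_diff_distrib scaleC_mult_left)
  finally have "poly_at x p * v = poly_at x q * (x * v - l *\<^sub>C v)"
    by (simp only: right_diff_distrib scaleC_mult_right mult.assoc)
  then obtain ls where "foldl (\<lambda>v l. x * v - l *\<^sub>C v) (x * v - l *\<^sub>C v) ls = 0"
    using Suc q by metis
  then show ?case by (intro exI[of _ "l # ls"]) simp
qed

text \<open>Evaluate \<open>star v * x * v\<close> in two ways; \<open>star v * v\<close> is nonzero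
  by the C*-identity.\<close>

lemma eigenvalue_selfadjoint_real:
  fixes x v :: "'a::cstar_algebra"
  assumes "star x = x" "x * v = l *\<^sub>C v" "v \<noteq> 0"
  shows "cnj l = l"
proof -
  have "cnj l *\<^sub>C (star v * v) = star (x * v) * v"
    by (simp add: assms star_scaleC scaleC_mult_left)
  also have "\<dots> = star v * (x * v)"
    by (simp add: star_mult assms(1) mult.assoc)
  also have "\<dots> = l *\<^sub>C (star v * v)"
    by (simp add: assms scaleC_mult_right)
  finally show ?thesis using assms(3) star_mult_self_eq_0[of v] by simp
qed

text \<open>The induction splits \<open>x * v - m v\<close> into eigenvectors. Those for
  \<open>l \<noteq> m\<close>, divided by \<open>l - m\<close>, are subtracted from
  \<open>v\<close>, and the remainder \<open>w\<close> turns out to be an eigenvector for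
  \<open>m\<close>.\<close>

lemma eigenvector_decomposition:
  fixes x v :: "'a::cstar_algebra"
  assumes sa: "star x = x" and "foldl (\<lambda>v l. x * v - l *\<^sub>C v) v ls = 0"
  shows "\<exists>F u. finite F \<and> (\<forall>l\<in>F. x * u l = l *\<^sub>C u l) \<and> v = (\<Sum>l\<in>F. u l)"
  using assms(2)
proof (induction ls arbitrary: v)
  case Nil
  then show ?case by (intro exI[of _ "{}"]) simp
next
  case (Cons m ls)
  then have "foldl (\<lambda>v l. x * v - l *\<^sub>C v) (x * v - m *\<^sub>C v) ls = 0" by simp
  from Cons.IH[OF this] obtain F u where F: "finite F"
    and u: "\<And>l. l \<in> F \<Longrightarrow> x * u l = l *\<^sub>C u l" and v: "x * v - m *\<^sub>C v = (\<Sum>l\<in>F. u l)"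
    by blast
  define u' where "u' l = (1 / (l - m)) *\<^sub>C u l" for l
  define w where "w = v - (\<Sum>l\<in>F - {m}. u' l)"
  define z where "z = x * w - m *\<^sub>C w"
  have u': "x * u' l - m *\<^sub>C u' l = u l" "x * u' l = l *\<^sub>C u' l" if "l \<in> F - {m}" for l
  proof -
    show "x * u' l = l *\<^sub>C u' l"
      using that by (simp add: u'_def scaleC_mult_right u scaleC_scaleC mult.commute)
    then have "x * u' l - m *\<^sub>C u' l = (l - m) *\<^sub>C u' l"
      by (simp add: complex_vector.scale_left_diff_distrib)
    then show "x * u' l - m *\<^sub>C u' l = u l"
      using that by (simp add: u'_def scaleC_scaleC scaleC_one)
  qed
  have "z = (x * v - m *\<^sub>C v) - (\<Sum>l\<in>F - {m}. x * u' l - m *\<^sub>C u' l)"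
    by (simp add: z_def w_def sum_subtractf sum_distrib_left complex_vector.scale_sum_right
        complex_vector.scale_right_diff_distrib algebra_simps)
  also have "\<dots> = (\<Sum>l\<in>F. u l) - (\<Sum>l\<in>F - {m}. u l)"
    by (simp only: v) (simp add: u'(1))
  also have "\<dots> = (if m \<in> F then u m else 0)"
    using F by (simp add: sum.remove)
  finally have zz: "x * z = m *\<^sub>C z" using u by auto
  \<comment> \<open>A nonzero \<open>z\<close> would form a Jordan chain with \<open>w\<close>. But
    then \<open>m\<close> is real, and moving \<open>x - m\<close> across the involution makes
    \<open>star z * z\<close> vanish.\<close>
  have "z = 0"
  proof (rule ccontr)
    assume "z \<noteq> 0"
    then have m: "cnj m = m" using eigenvalue_selfadjoint_real sa zz by blast
    have "star z * z = (star w * x - m *\<^sub>C star w) * z"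
      by (subst (1) z_def) (simp add: star_diff star_mult sa star_scaleC m)
    also have "\<dots> = star w * (x * z - m *\<^sub>C z)"
      by (simp add: algebra_simps scaleC_mult_left scaleC_mult_right)
    finally show False using \<open>z \<noteq> 0\<close> by (simp add: zz star_mult_self_eq_0)
  qed
  then have w: "x * w = m *\<^sub>C w" by (simp add: z_def)
  define u'' where "u'' l = (if l = m then w else u' l)" for l
  have "v = (\<Sum>l\<in>insert m F. u'' l)"
  proof -
    have "(\<Sum>l\<in>F - {m}. u'' l) = (\<Sum>l\<in>F - {m}. u' l)"
      by (rule sum.cong) (auto simp: u''_def)
    moreover have "u'' m = w" by (simp add: u''_def)
    ultimately show ?thesis using F by (simp add: sum.insert_remove w_def)
  qed
  moreover have "\<forall>l\<in>insert m F. x * u'' l = l *\<^sub>C u'' l"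
    by (auto simp: u''_def w u')
  ultimately show ?case using F by (intro exI[of _ "insert m F"] exI[of _ u'']) simp
qed

text \<open>The projections are the components of \<open>1\<close> in its decomposition into
  eigenvectors of left multiplication by \<open>x\<close>.\<close>

theorem spectral_decomposition:
  fixes x :: "'a::fd_cstar_algebra"
  assumes sa: "star x = x"
  obtains F :: "real set" and p :: "real \<Rightarrow> 'a"
  where "finite F" "(\<Sum>l\<in>F. p l) = 1"
    and "\<And>l. l \<in> F \<Longrightarrow> p l \<noteq> 0" "\<And>l. l \<in> F \<Longrightarrow> star (p l) = p l"
    and "\<And>l. l \<in> F \<Longrightarrow> x * p l = l *\<^sub>R p l"
    and "\<And>l m. l \<in> F \<Longrightarrow> m \<in> F \<Longrightarrow> p l * p m = (if l = m then p l else 0)"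
proof -
  obtain q where "q \<noteq> 0" "poly_at x q = 0" using ex_annihilating_poly .
  then obtain ls where ls: "foldl (\<lambda>v l. x * v - l *\<^sub>C v) 1 ls = 0"
    using ex_annihilating_factors[of q x 1] by auto
  obtain G u where G: "finite G" and u: "\<And>l. l \<in> G \<Longrightarrow> x * u l = l *\<^sub>C u l"
    and one: "1 = (\<Sum>l\<in>G. u l)"
    using eigenvector_decomposition[OF sa ls] by (elim exE conjE) (rule that; simp)
  have orth: "star (u l) * u m = 0" if "l \<in> G" "m \<in> G" "l \<noteq> m" for l m
  proof (cases "u l = 0")
    case False
    then have l: "cnj l = l" using eigenvalue_selfadjoint_real sa u that(1) by blast
    have "l *\<^sub>C (star (u l) * u m) = star (x * u l) * u m"
      by (simp add: u that star_scaleC l scaleC_mult_left)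
    also have "\<dots> = star (u l) * (x * u m)" by (simp add: star_mult sa mult.assoc)
    also have "\<dots> = m *\<^sub>C (star (u l) * u m)" by (simp add: u that scaleC_mult_right)
    finally show ?thesis using that(3) by simp
  qed simp
  \<comment> \<open>Multiply the decomposition of \<open>1\<close> by \<open>star (u l)\<close>: the
    cross terms vanish. The identity makes \<open>u l\<close> a self-adjoint idempotent.\<close>
  have self: "star (u l) = star (u l) * u l" if "l \<in> G" for l
  proof -
    have "star (u l) = (\<Sum>m\<in>G. star (u l) * u m)"
      by (simp flip: sum_distrib_left one)
    also have "\<dots> = (\<Sum>m\<in>G. if m = l then star (u l) * u l else 0)"
      using that orth by (intro sum.cong) auto
    finally show ?thesis using that G by simp
  qed
  have sau: "star (u l) = u l" if "l \<in> G" for l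
    using self[OF that] by (metis star_mult star_star)
  \<comment> \<open>Zero components are dropped, since only a nonzero one is known to have a real
    eigenvalue, which \<open>Re\<close> then preserves.\<close>
  define F where "F = Re ` {l \<in> G. u l \<noteq> 0}"
  have cplx: "complex_of_real (Re l) = l" if "l \<in> G" "u l \<noteq> 0" for l
    using eigenvalue_selfadjoint_real[OF sa u[OF that(1)] that(2)] by (simp add: complex_eq_iff)
  have FG: "of_real l \<in> G" "u (of_real l) \<noteq> 0" if "l \<in> F" for l
    using that cplx by (auto simp: F_def)
  show thesis
  proof (rule that[of F "\<lambda>l. u (of_real l)"])
    show "finite F" using G by (simp add: F_def)
    have "(\<Sum>l\<in>F. u (of_real l)) = (\<Sum>l\<in>{l \<in> G. u l \<noteq> 0}. u l)"
      unfolding F_def using cplx by (subst sum.reindex) (auto intro: inj_on_inverseI[where g = of_real])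
    also have "\<dots> = (\<Sum>l\<in>G. u l)" using G by (intro sum.mono_neutral_left) auto
    finally show "(\<Sum>l\<in>F. u (of_real l)) = 1" by (simp add: one)
    show "u (of_real l) \<noteq> 0" "star (u (of_real l)) = u (of_real l)"
      "x * u (of_real l) = l *\<^sub>R u (of_real l)" if "l \<in> F" for l
      using FG[OF that] by (simp_all add: sau u scaleR_scaleC)
    show "u (of_real l) * u (of_real m) = (if l = m then u (of_real l) else 0)"
      if "l \<in> F" "m \<in> F" for l m
      using FG[OF that(1)] FG[OF that(2)] orth[of "of_real l" "of_real m"] self[of "of_real l"]
      by (auto simp: sau)
  qed
qed

text \<open>Compare the two spectral decompositions. Equality of the exponentials forces
  \<open>q m * p l = 0\<close> unless \<open>m = l\<close>, because the real exponential is
  injective; so every block of \<open>h - g\<close> vanishes.\<close>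

lemma exp_selfadjoint_inj:
  fixes g h :: "'a::fd_cstar_algebra"
  assumes "star g = g" "star h = h" and eq: "exp g = exp h"
  shows "g = h"
proof -
  obtain F p where F: "finite F" and p1: "(\<Sum>l\<in>F. p l) = 1" and p: "\<And>l. l \<in> F \<Longrightarrow> g * p l = l *\<^sub>R p l"
    using spectral_decomposition[OF assms(1)] by metis
  obtain G q where G: "finite G" and q1: "(\<Sum>l\<in>G. q l) = 1"
    and q: "\<And>l. l \<in> G \<Longrightarrow> star (q l) = q l" "\<And>l. l \<in> G \<Longrightarrow> h * q l = l *\<^sub>R q l"
    using spectral_decomposition[OF assms(2)] by metis
  have "q m * (h - g) * p l = 0" if "m \<in> G" "l \<in> F" for l m
  proof -
    have qh: "q m * h = m *\<^sub>R q m"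
      using arg_cong[OF q(2)[OF that(1)], of star] by (simp add: star_mult assms q(1) that star_scaleR)
    have qe: "q m * exp h = exp m *\<^sub>R q m"
      using arg_cong[OF exp_mult_eigenvector[OF q(2)[OF that(1)]], of star]
      by (simp add: star_mult assms(2) q(1) that star_scaleR star_exp)
    have "exp m *\<^sub>R (q m * p l) = q m * exp h * p l" by (simp add: qe)
    also have "\<dots> = q m * (exp g * p l)" by (simp add: eq mult.assoc)
    also have "\<dots> = exp l *\<^sub>R (q m * p l)"
      by (simp add: exp_mult_eigenvector[OF p[OF that(2)]])
    finally have "m = l \<or> q m * p l = 0" by simp
    moreover have "q m * (h - g) * p l = (m - l) *\<^sub>R (q m * p l)"
      by (simp add: algebra_simps qh p[OF that(2)] mult.assoc)
    ultimately show ?thesis by auto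
  qed
  then have "(\<Sum>m\<in>G. q m) * (h - g) * (\<Sum>l\<in>F. p l) = 0"
    by (simp add: sum_distrib_left sum_distrib_right)
  then show ?thesis by (simp add: p1 q1)
qed

text \<open>\<open>ln\<close> is applied to each spectral value. Its sign is read off with the
  state: \<open>\<psi>\<close> is nonnegative on \<open>star (p l) * Q * p l\<close> and positive on
  \<open>star (p l) * p l\<close>, and the ratio is \<open>l\<close>. Invertibility excludes
  \<open>0\<close>.\<close>

lemma ex_selfadjoint_log:
  fixes Q :: "'a::fd_cstar_algebra" and \<psi> :: "'a \<Rightarrow> complex"
  assumes state: "faithful_state \<psi>" and pos: "cstar_pos Q" and inv: "R * Q = 1"
  shows "\<exists>h. star h = h \<and> exp h = Q"
proof -
  obtain y where y: "Q = star y * y" using pos by (auto simp: cstar_pos_def)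
  have sa: "star Q = Q" by (simp add: y star_mult star_star)
  obtain F p where F: "finite F" and p1: "(\<Sum>l\<in>F. p l) = 1"
    and p: "\<And>l. l \<in> F \<Longrightarrow> p l \<noteq> 0" "\<And>l. l \<in> F \<Longrightarrow> star (p l) = p l"
      "\<And>l. l \<in> F \<Longrightarrow> Q * p l = l *\<^sub>R p l"
    and orth: "\<And>l m. l \<in> F \<Longrightarrow> m \<in> F \<Longrightarrow> p l * p m = (if l = m then p l else 0)"
    using spectral_decomposition[OF sa] by metis
  have pos: "l > 0" if l: "l \<in> F" for l
  proof -
    have psi: "clinear \<psi>" "\<And>a. \<psi> (star a * a) \<in> \<real>\<^sub>\<ge>\<^sub>0" "\<And>a. \<psi> (star a * a) = 0 \<Longrightarrow> star a * a = 0"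
      using state by (auto simp: faithful_state_def cstar_pos_def)
    have "star (y * p l) * (y * p l) = star (p l) * (Q * p l)"
      by (simp add: y star_mult mult.assoc)
    also have "\<dots> = complex_of_real l *\<^sub>C (star (p l) * p l)"
      by (simp add: p l scaleR_scaleC scaleC_mult_right)
    finally have "\<psi> (star (y * p l) * (y * p l)) = complex_of_real l * \<psi> (star (p l) * p l)"
      by (simp add: clinear_scale[OF psi(1)] scaleC_complex_def)
    moreover have "\<psi> (star (p l) * p l) \<noteq> 0"
      using psi(3)[of "p l"] p(1)[OF l] by (auto simp: star_mult_self_eq_0)
    ultimately have "l \<ge> 0"
      using psi(2)[of "y * p l"] psi(2)[of "p l"]
      by (auto simp: complex_nonneg_Reals_iff complex_eq_iff zero_le_mult_iff)
    moreover have "l \<noteq> 0"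
    proof
      assume "l = 0"
      then have "R * (Q * p l) = 0" using p(3)[OF l] by simp
      then show False using p(1)[OF l] inv by (simp flip: mult.assoc)
    qed
    ultimately show ?thesis by simp
  qed
  define h where "h = (\<Sum>l\<in>F. ln l *\<^sub>R p l)"
  have hp: "h * p l = ln l *\<^sub>R p l" if "l \<in> F" for l
  proof -
    have "h * p l = (\<Sum>m\<in>F. if m = l then ln l *\<^sub>R p l else 0)"
      unfolding h_def sum_distrib_right using that orth by (intro sum.cong) auto
    then show ?thesis using F that by simp
  qed
  have "exp h = (\<Sum>l\<in>F. exp h * p l)" by (simp add: p1 flip: sum_distrib_left)
  also have "\<dots> = (\<Sum>l\<in>F. Q * p l)"
    using pos by (intro sum.cong) (simp_all add: exp_mult_eigenvector[OF hp] p)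
  also have "\<dots> = Q" by (simp add: p1 flip: sum_distrib_left)
  finally have "exp h = Q" .
  moreover have "star h = h" by (simp add: h_def star_sum star_scaleR p)
  ultimately show ?thesis by blast
qed

text \<open>Existence and uniqueness of a self-adjoint logarithm give meaning to the description in
  \<open>cstar_log\<close>.\<close>

lemma star_cstar_log:
  fixes Q :: "'a::fd_cstar_algebra" and \<psi> :: "'a \<Rightarrow> complex"
  assumes "faithful_state \<psi>" "cstar_pos Q" "R * Q = 1"
  shows "star (cstar_log Q) = cstar_log Q"
proof -
  have "\<exists>!h. star h = h \<and> exp h = Q"
    by (rule ex_ex1I[OF ex_selfadjoint_log[OF assms]]) (simp add: exp_selfadjoint_inj)
  from theI'[OF this] show ?thesis by (simp add: cstar_log_def)
qed

text \<open>As \<open>log Q\<close> is self-adjoint, the involution conjugates the exponents and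
  exchanges the two outer factors. So the parameter \<open>\<i> / 2\<close> of
  \<open>Psi'_0_half\<close> becomes the \<open>- \<i> / 2\<close> of \<open>Psi'\<close>.\<close>

lemma star_modular:
  fixes Q :: "'a::cstar_algebra"
  assumes "star (cstar_log Q) = cstar_log Q"
  shows "star (modular Q z a) = modular Q (cnj z) (star a)"
  by (simp add: modular_def cpower_def star_mult star_exp star_scaleC star_minus assms mult.assoc)

lemma clinear_modular: "clinear (modular Q z)"
  unfolding modular_def[abs_def] by (rule clinear_compose[OF clinear_mult_left clinear_mult_right])

section \<open>Gram matrices\<close>

definition fun_ip :: "'x set \<Rightarrow> ('x \<Rightarrow> complex) \<Rightarrow> ('x \<Rightarrow> complex) \<Rightarrow> complex" where
  "fun_ip X f g = (\<Sum>x\<in>X. cnj (f x) * g x)"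

lemma fun_ip_cnj: "cnj (fun_ip X f g) = fun_ip X g f"
  by (simp add: fun_ip_def mult.commute)

lemma fun_ip_self: "fun_ip X f f = of_real (\<Sum>x\<in>X. (cmod (f x))\<^sup>2)"
  by (simp add: fun_ip_def complex_norm_square mult.commute flip: of_real_power)

text \<open>The form ignores values outside \<open>X\<close>, so a null function may be nonzero; it
  is still orthogonal to everything.\<close>

lemma fun_ip_self_0:
  assumes "finite X" "fun_ip X f f = 0"
  shows "fun_ip X f g = 0"
proof -
  have "(\<Sum>x\<in>X. (cmod (f x))\<^sup>2) = 0" using assms(2) by (simp only: fun_ip_self of_real_eq_0_iff)
  then have "\<forall>x\<in>X. f x = 0" using assms(1) by (simp add: sum_nonneg_eq_0_iff)
  then show ?thesis by (simp add: fun_ip_def)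
qed

lemma fun_ip_sum_right:
  "fun_ip X f (\<lambda>x. \<Sum>k\<in>J. c k * g k x) = (\<Sum>k\<in>J. c k * fun_ip X f (g k))"
  unfolding fun_ip_def sum_distrib_left by (subst sum.swap) (simp add: mult_ac)

lemma fun_ip_diff_right: "fun_ip X f (\<lambda>x. g x - h x) = fun_ip X f g - fun_ip X f h"
  by (simp add: fun_ip_def sum_subtractf right_diff_distrib)

text \<open>The orthogonal vectors are not normalized, may be null and are indexed by
  \<open>J\<close> itself, so that dependent families are covered.\<close>

lemma gram_schmidt:
  fixes z :: "'j \<Rightarrow> 'x \<Rightarrow> complex"
  assumes X: "finite X" and J: "finite J"
  shows "\<exists>e c. (\<forall>i\<in>J. \<forall>j\<in>J. i \<noteq> j \<longrightarrow> fun_ip X (e i) (e j) = 0) \<and>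
    (\<forall>j\<in>J. z j = (\<lambda>x. \<Sum>k\<in>J. c k j * e k x))"
  using J
proof induction
  case empty
  then show ?case by simp
next
  case (insert a J)
  from insert.IH obtain e c where orth: "\<And>i j. i \<in> J \<Longrightarrow> j \<in> J \<Longrightarrow> i \<noteq> j \<Longrightarrow> fun_ip X (e i) (e j) = 0"
    and z: "\<And>j. j \<in> J \<Longrightarrow> z j = (\<lambda>x. \<Sum>k\<in>J. c k j * e k x)"
    by (elim exE conjE) (rule that; simp)
  \<comment> \<open>The projection coefficient. For a null \<open>e k\<close> the division yields
    \<open>0\<close>, and \<open>fun_ip_self_0\<close> then gives the orthogonality of the
    remainder.\<close>
  define b where "b k = fun_ip X (e k) (z a) / fun_ip X (e k) (e k)" for k
  define r where "r x = z a x - (\<Sum>k\<in>J. b k * e k x)" for x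
  define e' where "e' = e(a := r)"
  define c' where "c' k j = (if j = a then if k = a then 1 else b k else if k = a then 0 else c k j)" for k j
  have r: "fun_ip X (e l) r = 0" if l: "l \<in> J" for l
  proof -
    have "(\<Sum>k\<in>J. b k * fun_ip X (e l) (e k)) = (\<Sum>k\<in>J. if k = l then b l * fun_ip X (e l) (e l) else 0)"
      using orth l by (intro sum.cong) auto
    also have "\<dots> = fun_ip X (e l) (z a)"
      using l insert.hyps fun_ip_self_0[OF X, of "e l" "z a"] by (simp add: b_def)
    finally show ?thesis
      unfolding r_def[abs_def] fun_ip_diff_right fun_ip_sum_right by simp
  qed
  have r': "fun_ip X r (e l) = 0" if l: "l \<in> J" for l
    using r[OF l] fun_ip_cnj[of X "e l" r] by simp
  have ne: "k \<noteq> a" if "k \<in> J" for k using that insert.hyps by auto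
  have orth': "\<forall>i\<in>insert a J. \<forall>j\<in>insert a J. i \<noteq> j \<longrightarrow> fun_ip X (e' i) (e' j) = 0"
    using orth r r' ne by (auto simp: e'_def)
  have z': "z j = (\<lambda>x. \<Sum>k\<in>insert a J. c' k j * e' k x)" if j: "j \<in> insert a J" for j
  proof
    fix x
    have "(\<Sum>k\<in>J. c' k j * e' k x) = (\<Sum>k\<in>J. (if j = a then b k else c k j) * e k x)"
      using ne by (intro sum.cong) (auto simp: c'_def e'_def)
    then have "(\<Sum>k\<in>insert a J. c' k j * e' k x) =
        c' a j * r x + (\<Sum>k\<in>J. (if j = a then b k else c k j) * e k x)"
      using insert.hyps by (simp add: e'_def)
    also have "\<dots> = z j x"
    proof (cases "j = a")
      case True
      then show ?thesis by (simp add: c'_def r_def)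
    next
      case False
      then show ?thesis using j by (simp add: c'_def z)
    qed
    finally show "z j x = (\<Sum>k\<in>insert a J. c' k j * e' k x)" ..
  qed
  show ?case
    by (rule exI[of _ e'], rule exI[of _ c'], rule conjI[OF orth'], rule ballI, rule z')
qed

text \<open>The coefficients in the orthogonal system, scaled by the norms \<open>s k\<close>, form
  a factor whose summation index is \<open>J\<close> instead of \<open>X\<close>, that is, a square
  one.\<close>

lemma gram_factorization:
  fixes z :: "'j \<Rightarrow> 'x \<Rightarrow> complex"
  assumes X: "finite X" and J: "finite J"
  obtains w where "\<And>i j. i \<in> J \<Longrightarrow> j \<in> J \<Longrightarrow> fun_ip X (z i) (z j) = (\<Sum>k\<in>J. cnj (w k i) * w k j)"
proof -
  obtain e c where orth: "\<And>i j. i \<in> J \<Longrightarrow> j \<in> J \<Longrightarrow> i \<noteq> j \<Longrightarrow> fun_ip X (e i) (e j) = 0"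
    and z: "\<And>j. j \<in> J \<Longrightarrow> z j = (\<lambda>x. \<Sum>k\<in>J. c k j * e k x)"
    using gram_schmidt[OF X J, of z] by (elim exE conjE) (rule that; simp)
  define s where "s k = complex_of_real (sqrt (\<Sum>x\<in>X. (cmod (e k x))\<^sup>2))" for k
  have s: "cnj (s k) * s k = fun_ip X (e k) (e k)" for k
    by (simp add: s_def fun_ip_self sum_nonneg flip: of_real_mult)
  show thesis
  proof (rule that)
    fix i j assume ij: "i \<in> J" "j \<in> J"
    have z_e: "fun_ip X (z i) (e k) = cnj (c k i) * fun_ip X (e k) (e k)" if k: "k \<in> J" for k
    proof -
      have "fun_ip X (e k) (z i) = (\<Sum>l\<in>J. c l i * fun_ip X (e k) (e l))"
        by (simp add: z[OF ij(1)] fun_ip_sum_right)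
      also have "\<dots> = (\<Sum>l\<in>J. if l = k then c k i * fun_ip X (e k) (e k) else 0)"
        using orth k by (intro sum.cong) auto
      finally have "fun_ip X (e k) (z i) = c k i * fun_ip X (e k) (e k)"
        using k J by simp
      from arg_cong[OF this, of cnj] show ?thesis by (simp add: fun_ip_cnj)
    qed
    have "fun_ip X (z i) (z j) = (\<Sum>k\<in>J. c k j * fun_ip X (z i) (e k))"
      by (subst z[OF ij(2)]) (simp add: fun_ip_sum_right)
    also have "\<dots> = (\<Sum>k\<in>J. cnj (s k * c k i) * (s k * c k j))"
      by (intro sum.cong) (simp_all add: z_e mult_ac flip: s)
    finally show "fun_ip X (z i) (z j) = (\<Sum>k\<in>J. cnj (s k * c k i) * (s k * c k j))" .
  qed
qed

section \<open>Matrix blocks\<close>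

locale blocks =
  fixes K :: nat and d :: "nat \<Rightarrow> nat" and \<Phi> :: "'b::fd_cstar_algebra \<Rightarrow> nat \<Rightarrow> complex mat"
  assumes blocks: "matrix_blocks K d \<Phi>"
begin

lemma
  assumes "k < K"
  shows carrier: "\<Phi> a k \<in> carrier_mat (d k) (d k)"
    and add: "\<Phi> (a + b) k = \<Phi> a k + \<Phi> b k"
    and scale: "\<Phi> (c *\<^sub>C a) k = c \<cdot>\<^sub>m \<Phi> a k"
    and mult: "\<Phi> (a * b) k = \<Phi> a k * \<Phi> b k"
    and adjoint: "\<Phi> (star a) k = mat_adjoint (\<Phi> a k)"
  using blocks assms unfolding matrix_blocks_def by simp_all

lemma ex_preimage:
  assumes "\<And>k. k < K \<Longrightarrow> M k \<in> carrier_mat (d k) (d k)"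
  shows "\<exists>a. \<forall>k<K. \<Phi> a k = M k"
  using blocks unfolding matrix_blocks_def by (elim conjE allE[of _ M]) (simp add: assms)

lemma entry:
  assumes "k < K" "i < d k" "j < d k"
  shows entry_add: "\<Phi> (a + b) k $$ (i, j) = \<Phi> a k $$ (i, j) + \<Phi> b k $$ (i, j)"
    and entry_scale: "\<Phi> (c *\<^sub>C a) k $$ (i, j) = c * \<Phi> a k $$ (i, j)"
    and entry_mult: "\<Phi> (a * b) k $$ (i, j) = (\<Sum>l<d k. \<Phi> a k $$ (i, l) * \<Phi> b k $$ (l, j))"
    and entry_star: "\<Phi> (star a) k $$ (i, j) = cnj (\<Phi> a k $$ (j, i))"
proof -
  note car = carrier_matD[OF carrier[OF assms(1)]]
  show "\<Phi> (a + b) k $$ (i, j) = \<Phi> a k $$ (i, j) + \<Phi> b k $$ (i, j)"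
    "\<Phi> (c *\<^sub>C a) k $$ (i, j) = c * \<Phi> a k $$ (i, j)"
    "\<Phi> (star a) k $$ (i, j) = cnj (\<Phi> a k $$ (j, i))"
    using assms by (simp_all add: add scale adjoint car mat_adjoint_def mat_of_rows_def)
  show "\<Phi> (a * b) k $$ (i, j) = (\<Sum>l<d k. \<Phi> a k $$ (i, l) * \<Phi> b k $$ (l, j))"
    using assms by (simp add: mult car scalar_prod_def atLeast0LessThan)
qed

lemma entry_sum:
  assumes "k < K" "i < d k" "j < d k"
  shows "\<Phi> (\<Sum>x\<in>X. f x) k $$ (i, j) = (\<Sum>x\<in>X. \<Phi> (f x) k $$ (i, j))"
proof -
  have "\<Phi> 0 k $$ (i, j) = 0" using entry_scale[OF assms, of 0 0] by simp
  then show ?thesis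
    by (induction X rule: infinite_finite_induct) (simp_all add: entry_add assms)
qed

lemma eq_iff_entries:
  "a = b \<longleftrightarrow> (\<forall>k<K. \<forall>i<d k. \<forall>j<d k. \<Phi> a k $$ (i, j) = \<Phi> b k $$ (i, j))"
proof
  assume eq: "\<forall>k<K. \<forall>i<d k. \<forall>j<d k. \<Phi> a k $$ (i, j) = \<Phi> b k $$ (i, j)"
  have "\<forall>k<K. \<Phi> a k = \<Phi> b k"
  proof (intro allI impI)
    fix k assume k: "k < K"
    show "\<Phi> a k = \<Phi> b k"
      using eq k carrier_matD[OF carrier[OF k, of a]] carrier_matD[OF carrier[OF k, of b]]
      by (intro eq_matI) simp_all
  qed
  then show "a = b" using blocks unfolding matrix_blocks_def by simp
qed simp

abbreviation "\<tau> \<equiv> block_trace K d \<Phi>"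

lemma clinear_trace: "clinear \<tau>"
  by (rule clinearI) (simp_all add: block_trace_def entry_add entry_scale sum.distrib sum_distrib_left scaleC_complex_def)

lemma trace_commute: "\<tau> (a * b) = \<tau> (b * a)"
proof -
  have "(\<Sum>i<d k. \<Phi> (a * b) k $$ (i, i)) = (\<Sum>i<d k. \<Phi> (b * a) k $$ (i, i))" if "k < K" for k
  proof -
    have "(\<Sum>i<d k. \<Phi> (a * b) k $$ (i, i)) = (\<Sum>i<d k. \<Sum>l<d k. \<Phi> a k $$ (i, l) * \<Phi> b k $$ (l, i))"
      using that by (simp add: entry_mult)
    also have "\<dots> = (\<Sum>l<d k. \<Sum>i<d k. \<Phi> b k $$ (l, i) * \<Phi> a k $$ (i, l))"
      by (subst sum.swap) (simp add: mult.commute)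
    also have "\<dots> = (\<Sum>i<d k. \<Phi> (b * a) k $$ (i, i))"
      using that by (simp add: entry_mult)
    finally show ?thesis .
  qed
  then show ?thesis by (simp add: block_trace_def)
qed

lemma trace_star: "\<tau> (star a) = cnj (\<tau> a)"
  by (simp add: block_trace_def entry_star)

text \<open>These are the matrix units: \<open>e (k, i, j)\<close> has its single entry at row
  \<open>i\<close> and column \<open>j\<close> of block \<open>k\<close>, and the trace against its
  adjoint reads off that entry.\<close>

lemma ex_orthonormal_basis:
  obtains I :: "(nat \<times> nat \<times> nat) set" and e :: "nat \<times> nat \<times> nat \<Rightarrow> 'b"
  where "finite I" "\<And>b. b = (\<Sum>x\<in>I. \<tau> (star (e x) * b) *\<^sub>C e x)"
proof -
  define I where "I = Sigma {..<K} (\<lambda>k. {..<d k} \<times> {..<d k})"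
  define E where "E x k = mat (d k) (d k) (\<lambda>rs. if (k, rs) = x then 1 else 0 :: complex)" for x k
  have "\<exists>e. \<forall>k<K. \<Phi> e k = E x k" for x
    by (rule ex_preimage) (simp add: E_def)
  then obtain e where e: "\<And>x k. k < K \<Longrightarrow> \<Phi> (e x) k = E x k" by metis
  have trace_e: "\<tau> (star (e (k, i, j)) * b) = \<Phi> b k $$ (i, j)" if "(k, i, j) \<in> I" for k i j b
  proof -
    have kij: "k < K" "i < d k" "j < d k" using that by (auto simp: I_def)
    have "(\<Sum>r<d k'. \<Phi> (star (e (k, i, j)) * b) k' $$ (r, r)) =
        (if k' = k then \<Phi> b k $$ (i, j) else 0)" if k': "k' < K" for k'
    proof -
      have "\<Phi> (star (e (k, i, j)) * b) k' $$ (r, r) =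
          (if k' = k \<and> r = j then \<Phi> b k $$ (i, j) else 0)" if r: "r < d k'" for r
      proof -
        have "\<Phi> (star (e (k, i, j)) * b) k' $$ (r, r) =
            (\<Sum>s<d k'. cnj (E (k, i, j) k' $$ (s, r)) * \<Phi> b k' $$ (s, r))"
          using k' r by (simp add: entry_mult entry_star e)
        also have "\<dots> = (\<Sum>s<d k'. if s = i then if k' = k \<and> r = j then \<Phi> b k $$ (i, j) else 0 else 0)"
          using r by (intro sum.cong) (auto simp: E_def)
        finally show ?thesis using kij by simp
      qed
      then show ?thesis using kij by simp
    qed
    then show ?thesis using kij by (simp add: block_trace_def)
  qed
  show thesis
  proof (rule that)
    show fin: "finite I" by (simp add: I_def)
    show "b = (\<Sum>x\<in>I. \<tau> (star (e x) * b) *\<^sub>C e x)" for b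
      unfolding eq_iff_entries
    proof (intro allI impI)
      fix k i j assume kij: "k < K" "i < d k" "j < d k"
      have "\<Phi> (\<Sum>x\<in>I. \<tau> (star (e x) * b) *\<^sub>C e x) k $$ (i, j) =
          (\<Sum>x\<in>I. \<tau> (star (e x) * b) * E x k $$ (i, j))"
        using kij by (simp add: entry_sum entry_scale e)
      also have "\<dots> = (\<Sum>x\<in>I. if x = (k, i, j) then \<Phi> b k $$ (i, j) else 0)"
        using kij trace_e by (intro sum.cong) (auto simp: E_def)
      also have "\<dots> = \<Phi> b k $$ (i, j)"
        using kij fin by (simp add: I_def)
      finally show "\<Phi> b k $$ (i, j) = \<Phi> (\<Sum>x\<in>I. \<tau> (star (e x) * b) *\<^sub>C e x) k $$ (i, j)" ..
    qed
  qed
qed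

text \<open>In each block the left side is the Gram matrix of the columns of the
  \<open>Z r p\<close>, indexed by \<open>{..<n} \<times> {..<d k}\<close>. A square factor of it
  regroups into an \<open>n\<close> by \<open>n\<close> array over the algebra, whatever the size of
  \<open>R\<close>.\<close>

lemma ex_square_factor:
  fixes Z :: "'r \<Rightarrow> nat \<Rightarrow> 'b"
  assumes "finite R"
  obtains Y :: "nat \<Rightarrow> nat \<Rightarrow> 'b"
  where "\<And>p q. p < n \<Longrightarrow> q < n \<Longrightarrow>
    (\<Sum>r\<in>R. star (Z r p) * Z r q) = (\<Sum>s<n. star (Y s p) * Y s q)"
proof -
  define z where "z k = (\<lambda>(p, i) (r, l). \<Phi> (Z r p) k $$ (l, i))" for k
  define X where "X k = R \<times> {..<d k}" for k
  define J where "J k = {..<n} \<times> {..<d k}" for k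
  have "\<exists>w. \<forall>i\<in>J k. \<forall>j\<in>J k. fun_ip (X k) (z k i) (z k j) = (\<Sum>s\<in>J k. cnj (w s i) * w s j)" for k
  proof -
    have "finite (X k)" "finite (J k)" using assms by (simp_all add: X_def J_def)
    from gram_factorization[OF this, of "z k"] show ?thesis by metis
  qed
  then obtain w where w: "\<And>k i j. i \<in> J k \<Longrightarrow> j \<in> J k \<Longrightarrow>
      fun_ip (X k) (z k i) (z k j) = (\<Sum>s\<in>J k. cnj (w k s i) * w k s j)"
    by metis
  \<comment> \<open>The summation index \<open>(s, l)\<close> is split: \<open>s\<close> picks an
    element of the array, \<open>l\<close> a row inside its block.\<close>
  have "\<exists>y. \<forall>k<K. \<Phi> y k = mat (d k) (d k) (\<lambda>(l, i). w k (s, l) (p, i))" for s p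
    by (rule ex_preimage) simp
  then obtain Y where Y: "\<And>s p k. k < K \<Longrightarrow> \<Phi> (Y s p) k = mat (d k) (d k) (\<lambda>(l, i). w k (s, l) (p, i))"
    by metis
  show thesis
  proof (rule that[of Y])
    fix p q assume pq: "p < n" "q < n"
    show "(\<Sum>r\<in>R. star (Z r p) * Z r q) = (\<Sum>s<n. star (Y s p) * Y s q)"
      unfolding eq_iff_entries
    proof (intro allI impI)
      fix k i j assume kij: "k < K" "i < d k" "j < d k"
      have "\<Phi> (\<Sum>r\<in>R. star (Z r p) * Z r q) k $$ (i, j) = fun_ip (X k) (z k (p, i)) (z k (q, j))"
        using kij by (simp add: entry_sum entry_mult entry_star fun_ip_def X_def z_def sum.cartesian_product split_beta)
      also have "\<dots> = (\<Sum>s\<in>J k. cnj (w k s (p, i)) * w k s (q, j))"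
        using pq kij by (intro w) (simp_all add: J_def)
      also have "\<dots> = \<Phi> (\<Sum>s<n. star (Y s p) * Y s q) k $$ (i, j)"
        using kij by (simp add: entry_sum entry_mult entry_star J_def Y sum.cartesian_product split_beta)
      finally show "\<Phi> (\<Sum>r\<in>R. star (Z r p) * Z r q) k $$ (i, j) =
          \<Phi> (\<Sum>s<n. star (Y s p) * Y s q) k $$ (i, j)" .
    qed
  qed
qed

end

section \<open>Positivity\<close>

text \<open>Replaces the matrix product by sums in the algebra, the form in which
  \<open>ex_square_factor\<close> delivers a factor.\<close>

lemma mat_pos_iff:
  "mat_pos n X \<longleftrightarrow> X \<in> carrier_mat n n \<and>
    (\<exists>Y. \<forall>p<n. \<forall>q<n. X $$ (p, q) = (\<Sum>s<n. star (Y s p) * Y s q))"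
proof (intro iffI conjI)
  assume "mat_pos n X"
  then obtain Y where Y: "Y \<in> carrier_mat n n" "X = map_mat star (transpose_mat Y) * Y"
    by (auto simp: mat_pos_def)
  then show "X \<in> carrier_mat n n" by auto
  show "\<exists>Y. \<forall>p<n. \<forall>q<n. X $$ (p, q) = (\<Sum>s<n. star (Y s p) * Y s q)"
    using Y by (intro exI[of _ "\<lambda>s p. Y $$ (s, p)"]) (auto simp: scalar_prod_def atLeast0LessThan)
next
  assume "X \<in> carrier_mat n n \<and>
    (\<exists>Y. \<forall>p<n. \<forall>q<n. X $$ (p, q) = (\<Sum>s<n. star (Y s p) * Y s q))"
  then obtain Y where X: "X \<in> carrier_mat n n"
    and Y: "\<And>p q. p < n \<Longrightarrow> q < n \<Longrightarrow> X $$ (p, q) = (\<Sum>s<n. star (Y s p) * Y s q)"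
    by auto
  have "X = map_mat star (transpose_mat (mat n n (\<lambda>(s, p). Y s p))) * mat n n (\<lambda>(s, p). Y s p)"
    using X by (intro eq_matI) (auto simp: Y scalar_prod_def atLeast0LessThan)
  then show "mat_pos n X"
    by (auto simp: mat_pos_def)
qed

text \<open>The case of \<open>1\<close> by \<open>1\<close> matrices shows that \<open>f\<close>
  maps each \<open>star y * y\<close> to a self-adjoint element. Self-adjoint elements are
  differences of such squares up to a scalar, and they span the algebra.\<close>

lemma completely_positive_imp_real:
  fixes f :: "'a::cstar_algebra \<Rightarrow> 'a"
  assumes cp: "completely_positive f"
  shows "real_map f"
proof -
  have f: "clinear f" using cp by (simp add: completely_positive_def)
  have sq: "star (f (star y * y)) = f (star y * y)" for y
  proof -
    have "mat_pos 1 (mat 1 1 (\<lambda>_. star y * y))"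
      by (auto simp: mat_pos_iff intro: exI[of _ "\<lambda>_ _. y"])
    then have "mat_pos 1 (map_mat f (mat 1 1 (\<lambda>_. star y * y)))"
      using cp by (simp add: completely_positive_def)
    then obtain Y where "f (star y * y) = star Y * Y"
      by (auto simp: mat_pos_iff)
    then show ?thesis by (simp add: star_mult star_star)
  qed
  have sa: "star (f h) = f h" if h: "star h = h" for h
  proof -
    have "h = (1 / 4) *\<^sub>C (star (1 + h) * (1 + h) - star (1 - h) * (1 - h))"
    proof -
      have "star (1 + h) * (1 + h) - star (1 - h) * (1 - h) = h + h + h + h"
        by (simp add: star_add star_diff h algebra_simps)
      also have "\<dots> = 1 *\<^sub>C h + 1 *\<^sub>C h + 1 *\<^sub>C h + 1 *\<^sub>C h" by (simp only: scaleC_one)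
      also have "\<dots> = 4 *\<^sub>C h" by (simp only: scaleC_add_left[symmetric]) simp
      finally show ?thesis by (simp add: scaleC_scaleC scaleC_one)
    qed
    then have "f h = (1 / 4) *\<^sub>C (f (star (1 + h) * (1 + h)) - f (star (1 - h) * (1 - h)))"
      using clinear_scale[OF f] clinear_diff[OF f] by metis
    then show ?thesis by (simp only: star_scaleC star_diff[of "f _" "f _"] sq) simp
  qed
  show ?thesis
    unfolding real_map_def
  proof
    fix a :: 'a
    \<comment> \<open>\<open>h\<close> and \<open>k\<close> are twice the real and the imaginary
      part of \<open>a\<close>.\<close>
    define h where "h = a + star a"
    define k where "k = \<i> *\<^sub>C (star a - a)"
    have hk: "star h = h" "star k = k"
      by (simp_all add: h_def k_def star_add star_diff star_scaleC star_star add.commute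
          complex_vector.scale_right_diff_distrib)
    have ik: "\<i> *\<^sub>C k = a - star a" by (simp add: k_def scaleC_scaleC)
    have twice: "(1 / 2) *\<^sub>C (x + x) = x" for x :: 'a
    proof -
      have "x + x = 2 *\<^sub>C x" using scaleC_add_left[of 1 1 x] by (simp add: scaleC_one)
      then show ?thesis by (simp add: scaleC_scaleC scaleC_one)
    qed
    have a: "a = (1 / 2) *\<^sub>C (h + \<i> *\<^sub>C k)" "star a = (1 / 2) *\<^sub>C (h - \<i> *\<^sub>C k)"
      using twice[of a] twice[of "star a"] by (simp_all add: h_def ik)
    have "f a = (1 / 2) *\<^sub>C (f h + \<i> *\<^sub>C f k)"
      by (subst a(1)) (simp only: clinear_scale[OF f] clinear_add[OF f])
    then have "star (f a) = (1 / 2) *\<^sub>C (f h - \<i> *\<^sub>C f k)"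
      by (simp add: star_scaleC star_add sa hk)
    also have "\<dots> = f (star a)"
      by (subst a(2)) (simp only: clinear_scale[OF f] clinear_diff[OF f])
    finally show "f (star a) = star (f a)" ..
  qed
qed

section \<open>The GNS space\<close>

text \<open>Collects what the GNS computations take from the matrix blocks: a trace and a
  reproducing formula for it. The density \<open>Q\<close> comes with its inverse \<open>R\<close>
  and a factor \<open>y\<close>.\<close>

locale gns_frame =
  fixes \<tau> \<psi> :: "'b::cstar_algebra \<Rightarrow> complex" and Q R y :: 'b
    and \<Lambda> :: "'b \<Rightarrow> 'h::complex_vector" and ip :: "'h \<Rightarrow> 'h \<Rightarrow> complex"
    and I :: "'i set" and e :: "'i \<Rightarrow> 'b"
  assumes clinear_trace: "clinear \<tau>"
    and trace_commute: "\<And>a b. \<tau> (a * b) = \<tau> (b * a)"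
    and trace_star: "\<And>a. \<tau> (star a) = cnj (\<tau> a)"
    and finite_I: "finite I"
    and basis: "\<And>b. b = (\<Sum>i\<in>I. \<tau> (star (e i) * b) *\<^sub>C e i)"
    and Q_eq: "Q = star y * y" and QR: "Q * R = 1" and RQ: "R * Q = 1"
    and density: "\<And>a. \<psi> a = \<tau> (Q * a)"
    and gns: "gns \<psi> \<Lambda> ip"
begin

section \<open>Dual frames for the trace and for \<open>\<psi>\<close>\<close>

lemma star_Q: "star Q = Q"
  by (simp add: Q_eq star_mult star_star)

lemma star_R: "star R = R"
proof -
  have "star R * Q = 1" using arg_cong[OF QR, of star] by (simp add: star_mult star_Q)
  then have "star R * Q * R = R" by simp
  then show ?thesis by (simp add: mult.assoc QR)
qed

lemma Q_R_cancel: "Q * (R * a) = a" "R * (Q * a) = a"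
  by (simp_all add: QR RQ flip: mult.assoc)

lemma basis': "b = (\<Sum>i\<in>I. \<tau> (e i * b) *\<^sub>C star (e i))"
proof -
  have "cnj (\<tau> (star (e i) * star b)) = \<tau> (e i * b)" for i
    by (simp add: star_star trace_commute[of "e i"] flip: star_mult trace_star)
  then show ?thesis
    using arg_cong[OF basis[of "star b"], of star] by (simp add: star_sum star_scaleC star_star)
qed

text \<open>The factor \<open>R\<close> cancels the density, so \<open>R * star (e i)\<close> takes
  for \<open>\<psi>\<close> the part of \<open>star (e i)\<close> for the trace.\<close>

lemma \<psi>_frame: "b = (\<Sum>i\<in>I. \<psi> (R * star (e i) * b) *\<^sub>C e i)"
  by (subst basis) (simp add: density mult.assoc Q_R_cancel)

lemma \<psi>_frame': "(\<Sum>i\<in>I. \<psi> (c * e i) *\<^sub>C (R * star (e i))) = c"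
proof -
  have "\<psi> (c * e i) = \<tau> (e i * (Q * c))" for i
    using trace_commute[of "Q * c" "e i"] by (simp add: density mult.assoc)
  then have "(\<Sum>i\<in>I. \<psi> (c * e i) *\<^sub>C (R * star (e i))) = R * (\<Sum>i\<in>I. \<tau> (e i * (Q * c)) *\<^sub>C star (e i))"
    by (simp add: sum_distrib_left scaleC_mult_right)
  also have "\<dots> = R * (Q * c)" by (simp flip: basis')
  finally show ?thesis by (simp add: Q_R_cancel)
qed

text \<open>With \<open>e i\<close> on the left inside \<open>\<psi>\<close>, cyclicity of the trace
  moves \<open>Q\<close> behind \<open>c\<close>.\<close>

lemma \<psi>_frame_left: "(\<Sum>i\<in>I. \<psi> (e i * c) *\<^sub>C star (e i)) = c * Q"
proof -
  have "\<psi> (e i * c) = \<tau> (e i * (c * Q))" for i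
    using trace_commute[of Q "e i * c"] by (simp add: density mult.assoc)
  then show ?thesis by (simp flip: basis')
qed

lemma clinear_\<psi>: "clinear \<psi>"
  unfolding density[abs_def] by (rule clinear_compose[OF clinear_mult_left clinear_trace])

lemma \<psi>_star: "\<psi> (star a) = cnj (\<psi> a)"
  using trace_star[of "Q * a"] trace_commute[of "star a" Q] by (simp add: density star_mult star_Q)

text \<open>The element \<open>\<Sum>i. e i \<otimes> star (e i)\<close> of \<open>B \<otimes> B\<close> is the Casimir element of the trace.\<close>

lemma casimir_left:
  assumes \<beta>: "cbilinear \<beta>"
  shows "(\<Sum>i\<in>I. \<beta> (b * e i) (star (e i))) = (\<Sum>i\<in>I. \<beta> (e i) (star (e i) * b))"
proof -
  note l = cbilinearD(2)[OF \<beta>] and r = cbilinearD(1)[OF \<beta>]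
  have "\<beta> (b * e i) (star (e i)) = (\<Sum>j\<in>I. \<tau> (star (e j) * (b * e i)) *\<^sub>C \<beta> (e j) (star (e i)))" for i
    by (subst basis[of "b * e i"]) (simp only: clinear_sum[OF l] clinear_scale[OF l])
  moreover have "\<beta> (e j) (star (e j) * b) = (\<Sum>i\<in>I. \<tau> (star (e j) * (b * e i)) *\<^sub>C \<beta> (e j) (star (e i)))" for j
  proof -
    have "\<tau> (e i * (star (e j) * b)) = \<tau> (star (e j) * (b * e i))" for i
      using trace_commute[of "e i" "star (e j) * b"] by (simp add: mult.assoc)
    then show ?thesis
      by (subst basis'[of "star (e j) * b"]) (simp only: clinear_sum[OF r] clinear_scale[OF r])
  qed
  ultimately show ?thesis by (simp only:) (rule sum.swap)
qed

text \<open>Both sides expand, by \<open>basis\<close> and \<open>basis'\<close>, to one double sum;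
  cyclicity of the trace matches the coefficients.\<close>

lemma casimir_right:
  assumes \<beta>: "cbilinear \<beta>"
  shows "(\<Sum>i\<in>I. \<beta> (e i * b) (star (e i))) = (\<Sum>i\<in>I. \<beta> (e i) (b * star (e i)))"
proof -
  note l = cbilinearD(2)[OF \<beta>] and r = cbilinearD(1)[OF \<beta>]
  have "\<beta> (e i * b) (star (e i)) = (\<Sum>j\<in>I. \<tau> (star (e j) * (e i * b)) *\<^sub>C \<beta> (e j) (star (e i)))" for i
    by (subst basis[of "e i * b"]) (simp only: clinear_sum[OF l] clinear_scale[OF l])
  moreover have "\<beta> (e j) (b * star (e j)) = (\<Sum>i\<in>I. \<tau> (star (e j) * (e i * b)) *\<^sub>C \<beta> (e j) (star (e i)))" for j
  proof -
    have "\<tau> (e i * (b * star (e j))) = \<tau> (star (e j) * (e i * b))" for i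
      using trace_commute[of "star (e j)" "e i * b"] by (simp add: mult.assoc)
    then show ?thesis
      by (subst basis'[of "b * star (e j)"]) (simp only: clinear_sum[OF r] clinear_scale[OF r])
  qed
  ultimately show ?thesis by (simp only:) (rule sum.swap)
qed

section \<open>The GNS inner product and its frames\<close>

abbreviation V :: "'h \<Rightarrow> 'b" where "V \<equiv> inv_into UNIV \<Lambda>"

lemma clinear_\<Lambda>: "clinear \<Lambda>" and ip_\<Lambda>: "ip (\<Lambda> a) (\<Lambda> b) = \<psi> (star a * b)"
  using gns by (simp_all add: gns_def)

lemma V_\<Lambda> [simp]: "V (\<Lambda> a) = a"
  using gns by (simp add: gns_def bij_is_inj)

lemma \<Lambda>_V [simp]: "\<Lambda> (V \<xi>) = \<xi>"
  using gns by (simp add: gns_def bij_is_surj surj_f_inv_f)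

lemma \<Lambda>_eq_iff [simp]: "\<Lambda> a = \<Lambda> b \<longleftrightarrow> a = b"
  by (metis V_\<Lambda>)

lemma all_H: "(\<forall>\<xi>. P \<xi>) \<longleftrightarrow> (\<forall>a. P (\<Lambda> a))"
  by (metis \<Lambda>_V)

lemma clinear_V: "clinear V"
proof (rule clinearI)
  fix \<xi> \<zeta> :: 'h and c
  have "\<Lambda> (V (\<xi> + \<zeta>)) = \<Lambda> (V \<xi> + V \<zeta>)" by (simp only: clinear_add[OF clinear_\<Lambda>] \<Lambda>_V)
  then show "V (\<xi> + \<zeta>) = V \<xi> + V \<zeta>" by (simp only: \<Lambda>_eq_iff)
  have "\<Lambda> (V (c *\<^sub>C \<xi>)) = \<Lambda> (c *\<^sub>C V \<xi>)" by (simp only: clinear_scale[OF clinear_\<Lambda>] \<Lambda>_V)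
  then show "V (c *\<^sub>C \<xi>) = c *\<^sub>C V \<xi>" by (simp only: \<Lambda>_eq_iff)
qed

lemma ip_eq: "ip \<xi> \<zeta> = \<psi> (star (V \<xi>) * V \<zeta>)"
  using ip_\<Lambda>[of "V \<xi>" "V \<zeta>"] by simp

lemma ip_cnj: "cnj (ip \<xi> \<zeta>) = ip \<zeta> \<xi>"
  by (simp add: ip_eq star_mult star_star flip: \<psi>_star)

lemma sesquilinear_ip: "sesquilinear ip"
proof -
  have "clinear (ip \<xi>)" for \<xi>
    unfolding ip_eq[abs_def] by (rule clinear_compose[OF clinear_V clinear_compose[OF clinear_mult_left clinear_\<psi>]])
  then show ?thesis by (simp add: sesquilinear_def ip_cnj)
qed

text \<open>This is \<open>\<psi>_frame\<close> carried along \<open>\<Lambda>\<close>; the dual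
  vectors arise from \<open>star (e i * R) = R * star (e i)\<close>.\<close>

lemma ip_frame: "\<xi> = (\<Sum>i\<in>I. ip (\<Lambda> (e i * R)) \<xi> *\<^sub>C \<Lambda> (e i))"
proof -
  have "\<Lambda> (V \<xi>) = (\<Sum>i\<in>I. \<psi> (R * star (e i) * V \<xi>) *\<^sub>C \<Lambda> (e i))"
    by (subst \<psi>_frame[of "V \<xi>"]) (simp only: clinear_sum[OF clinear_\<Lambda>] clinear_scale[OF clinear_\<Lambda>])
  then show ?thesis by (simp add: ip_eq star_mult star_R)
qed

lemma ip_nondegenerate:
  assumes "\<And>\<zeta>. ip \<xi> \<zeta> = 0"
  shows "\<xi> = 0"
proof -
  have "ip \<zeta> \<xi> = 0" for \<zeta> using assms[of \<zeta>] ip_cnj[of \<xi> \<zeta>] by simp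
  then show ?thesis by (subst ip_frame) simp
qed

abbreviation "tip \<equiv> tensor_ip ip ip"

lemmas sesquilinear_tip = sesquilinear_tensor_ip[OF sesquilinear_ip sesquilinear_ip]
  and tip_elem = tensor_ip_elem[OF sesquilinear_ip sesquilinear_ip]

text \<open>Applying \<open>ip_frame\<close> in both factors recovers a tensor from its
  \<open>tip\<close> products.\<close>

lemma tip_nondegenerate:
  assumes "\<And>v. tip t v = 0"
  shows "t = 0"
proof -
  define E where "E i j t = cnj (tip t (\<Lambda> (e i * R) \<otimes>\<^sub>t \<Lambda> (e j * R))) *\<^sub>C (\<Lambda> (e i) \<otimes>\<^sub>t \<Lambda> (e j))" for i j t
  have lin: "clinear (\<lambda>t. \<Sum>i\<in>I. \<Sum>j\<in>I. E i j t)"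
    unfolding E_def by (rule clinear_sum_fun, rule clinear_sum_fun, rule clinear_coeff, rule sesquilinearD(2)[OF sesquilinear_tip])
  note el = cbilinearD[OF elem_tensor_bilinear]
  have "t = (\<Sum>i\<in>I. \<Sum>j\<in>I. E i j t)"
  proof (rule clinear_tensor_eqI[OF clinear_id lin])
    fix \<xi> \<zeta> :: 'h
    have left: "\<xi> \<otimes>\<^sub>t \<zeta> = (\<Sum>i\<in>I. ip (\<Lambda> (e i * R)) \<xi> *\<^sub>C (\<Lambda> (e i) \<otimes>\<^sub>t \<zeta>))"
      by (subst ip_frame[of \<xi>]) (simp only: clinear_sum[OF el(2)] clinear_scale[OF el(2)])
    have right: "\<Lambda> (e i) \<otimes>\<^sub>t \<zeta> = (\<Sum>j\<in>I. ip (\<Lambda> (e j * R)) \<zeta> *\<^sub>C (\<Lambda> (e i) \<otimes>\<^sub>t \<Lambda> (e j)))" for i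
      by (subst ip_frame[of \<zeta>]) (simp only: clinear_sum[OF el(1)] clinear_scale[OF el(1)])
    show "\<xi> \<otimes>\<^sub>t \<zeta> = (\<Sum>i\<in>I. \<Sum>j\<in>I. E i j (\<xi> \<otimes>\<^sub>t \<zeta>))"
      by (subst left, subst right) (simp add: E_def tip_elem ip_cnj complex_vector.scale_sum_right scaleC_scaleC)
  qed
  then show ?thesis by (simp add: E_def assms)
qed

section \<open>Multiplication, unit and their adjoints\<close>

lemma cbilinear_mult: "cbilinear (\<lambda>\<xi> \<zeta>. \<Lambda> (V \<xi> * V \<zeta>))"
  by (rule cbilinearI; rule clinearI)
    (simp_all add: clinear_add[OF clinear_V] clinear_scale[OF clinear_V] clinear_add[OF clinear_\<Lambda>]
      clinear_scale[OF clinear_\<Lambda>] distrib_left distrib_right scaleC_mult_left scaleC_mult_right)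

lemma clinear_mult_H: "clinear (mult_H \<Lambda>)"
  and mult_H: "mult_H \<Lambda> (\<xi> \<otimes>\<^sub>t \<zeta>) = \<Lambda> (V \<xi> * V \<zeta>)"
  unfolding mult_H_def by (rule tensor_lift[OF cbilinear_mult])+

lemma clinear_mult_B: "clinear (mult_B \<Lambda>)" and mult_B: "mult_B \<Lambda> (a \<otimes>\<^sub>t b) = a * b"
proof -
  show "clinear (mult_B \<Lambda>)"
    using clinear_compose[OF clinear_compose[OF clinear_tensor_map[OF clinear_\<Lambda> clinear_\<Lambda>] clinear_mult_H] clinear_V]
    by (simp add: mult_B_def o_def)
  show "mult_B \<Lambda> (a \<otimes>\<^sub>t b) = a * b"
    by (simp add: mult_B_def tensor_map_elem clinear_\<Lambda> mult_H)
qed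

lemma clinear_comult: "clinear (\<lambda>\<xi>. \<Sum>i\<in>I. \<Lambda> (V \<xi> * e i) \<otimes>\<^sub>t \<Lambda> (R * star (e i)))"
proof (rule clinear_sum_fun)
  fix i
  have "clinear (\<lambda>\<xi>. \<Lambda> (V \<xi> * e i))"
    by (rule clinear_compose[OF clinear_V clinear_compose[OF clinear_mult_right clinear_\<Lambda>]])
  then show "clinear (\<lambda>\<xi>. \<Lambda> (V \<xi> * e i) \<otimes>\<^sub>t \<Lambda> (R * star (e i)))"
    by (rule clinear_compose[OF _ cbilinearD(2)[OF elem_tensor_bilinear]])
qed

text \<open>The right side is linear, so by nondegeneracy only the adjoint relation has to be
  verified, and only on elementary tensors.\<close>

lemma comult_H: "comult_H \<Lambda> ip = (\<lambda>\<xi>. \<Sum>i\<in>I. \<Lambda> (V \<xi> * e i) \<otimes>\<^sub>t \<Lambda> (R * star (e i)))"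
  unfolding comult_H_def
proof (rule hilbert_adj_eqI[OF sesquilinear_tip tip_nondegenerate clinear_comult])
  fix v w
  let ?g = "\<lambda>\<xi>. \<Sum>i\<in>I. \<Lambda> (V \<xi> * e i) \<otimes>\<^sub>t \<Lambda> (R * star (e i))"
  have tip_sum: "tip (\<Sum>i\<in>I. f i) v = (\<Sum>i\<in>I. tip (f i) v)" for f v
    using arg_cong[OF clinear_sum[OF sesquilinearD(2)[OF sesquilinear_tip]], of cnj] by simp
  show "ip w (mult_H \<Lambda> v) = tip (?g w) v"
  proof (rule clinear_tensor_eqI[of "\<lambda>v. ip w (mult_H \<Lambda> v)" "tip (?g w)"])
    show "clinear (\<lambda>v. ip w (mult_H \<Lambda> v))"
      by (rule clinear_compose[OF clinear_mult_H sesquilinearD(1)[OF sesquilinear_ip]])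
    show "clinear (tip (?g w))" by (rule sesquilinearD(1)[OF sesquilinear_tip])
    fix \<xi> \<zeta> :: 'h
    define a b c where abc: "a = V \<xi>" "b = V w" "c = V \<zeta>"
    have "tip (?g w) (\<xi> \<otimes>\<^sub>t \<zeta>) = (\<Sum>i\<in>I. \<psi> (star (b * e i) * a) * \<psi> (star (R * star (e i)) * c))"
      unfolding tip_sum tip_elem by (simp add: ip_eq abc)
    also have "\<dots> = (\<Sum>i\<in>I. \<psi> (e i * (R * c)) * \<psi> (star (e i) * (star b * a)))"
      by (simp add: star_mult star_star star_R mult.assoc mult.commute)
    also have "\<dots> = \<psi> ((\<Sum>i\<in>I. \<psi> (e i * (R * c)) *\<^sub>C star (e i)) * (star b * a))"
      by (simp add: sum_distrib_right scaleC_mult_left clinear_sum[OF clinear_\<psi>] clinear_scale[OF clinear_\<psi>])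
    \<comment> \<open>The frame sum contracts to \<open>R * c * Q\<close>, and the \<open>Q\<close>
      contributed by the density cancels \<open>R\<close>.\<close>
    also have "\<dots> = \<tau> (Q * (R * (c * (Q * (star b * a)))))"
      by (simp only: \<psi>_frame_left) (simp only: density mult.assoc)
    also have "\<dots> = \<tau> (c * (Q * (star b * a)))" by (simp add: Q_R_cancel)
    also have "\<dots> = \<psi> (star b * (a * c))"
      using trace_commute[of c "Q * (star b * a)"] by (simp add: density mult.assoc)
    finally show "ip w (mult_H \<Lambda> (\<xi> \<otimes>\<^sub>t \<zeta>)) = tip (?g w) (\<xi> \<otimes>\<^sub>t \<zeta>)"
      by (simp add: mult_H ip_eq abc)
  qed
qed

lemma comult_B: "comult_B \<Lambda> ip = (\<lambda>b. \<Sum>i\<in>I. (b * e i) \<otimes>\<^sub>t (R * star (e i)))"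
  by (rule ext) (simp add: comult_B_def comult_H clinear_sum[OF clinear_tensor_map[OF clinear_V clinear_V]]
      tensor_map_elem[OF clinear_V clinear_V])

lemma clinear_comult_H: "clinear (comult_H \<Lambda> ip)"
  unfolding comult_H by (rule clinear_comult)

lemma clinear_comult_B: "clinear (comult_B \<Lambda> ip)"
  using clinear_compose[OF clinear_compose[OF clinear_\<Lambda> clinear_comult_H] clinear_tensor_map[OF clinear_V clinear_V]]
  by (simp add: comult_B_def o_def)

lemma counit_H: "counit_H \<Lambda> ip = ip (\<Lambda> 1)"
  unfolding counit_H_def
proof (rule hilbert_adj_eqI)
  show "sesquilinear (\<lambda>w z. cnj w * z)"
    unfolding sesquilinear_def by (intro conjI allI; rule clinearI) (simp_all add: algebra_simps)
  show "t = 0" if "\<And>v. cnj t * v = 0" for t using that[of 1] by simp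
  show "clinear (ip (\<Lambda> 1))" by (rule sesquilinearD(1)[OF sesquilinear_ip])
  show "ip w (unit_H \<Lambda> v) = cnj (ip (\<Lambda> 1) w) * v" for v w
    by (simp add: unit_H_def sesquilinear_simps[OF sesquilinear_ip] ip_cnj)
qed

lemma counit_B: "counit_B \<Lambda> ip = \<psi>"
  by (rule ext) (simp add: counit_B_def counit_H ip_\<Lambda>)

lemma clinear_unit_H: "clinear (unit_H \<Lambda>)"
  by (rule clinearI) (simp_all add: unit_H_def scaleC_add_left scaleC_scaleC)

lemma clinear_unit_B: "clinear (unit_B \<Lambda>)"
  using clinear_compose[OF clinear_unit_H clinear_V] by (simp add: unit_B_def o_def)

section \<open>The map \<open>A\<^sub>0\<close> and its transport \<open>A\<close> to the GNS
  space\<close>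

context
  fixes A\<^sub>0 :: "'b \<Rightarrow> 'b" and A :: "'h \<Rightarrow> 'h"
  assumes A0_linear: "clinear A\<^sub>0" and A_def: "\<And>a. A (\<Lambda> a) = \<Lambda> (A\<^sub>0 a)"
begin

lemma A_eq: "A \<xi> = \<Lambda> (A\<^sub>0 (V \<xi>))"
  using A_def[of "V \<xi>"] by simp

lemma A_linear: "clinear A"
  unfolding A_eq[abs_def] by (rule clinear_compose[OF clinear_V clinear_compose[OF A0_linear clinear_\<Lambda>]])

lemma schur_B: "schur_square (mult_B \<Lambda>) (comult_B \<Lambda> ip) A\<^sub>0 b = (\<Sum>i\<in>I. A\<^sub>0 (b * e i) * A\<^sub>0 (R * star (e i)))"
  by (simp add: schur_square_eq[OF clinear_mult_B A0_linear fun_cong[OF comult_B]] mult_B)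

lemma schur_H: "schur_square (mult_H \<Lambda>) (comult_H \<Lambda> ip) A (\<Lambda> b) =
    \<Lambda> (schur_square (mult_B \<Lambda>) (comult_B \<Lambda> ip) A\<^sub>0 b)"
  by (simp add: schur_square_eq[OF clinear_mult_H A_linear fun_cong[OF comult_H]] mult_H schur_B
      A_def clinear_sum[OF clinear_\<Lambda>])

lemma schur_iff: "schur_square (mult_H \<Lambda>) (comult_H \<Lambda> ip) A = A \<longleftrightarrow>
    schur_square (mult_B \<Lambda>) (comult_B \<Lambda> ip) A\<^sub>0 = A\<^sub>0"
  by (simp add: fun_eq_iff all_H schur_H A_def)

lemma bend_B: "bend (mult_B \<Lambda>) (comult_B \<Lambda> ip) (unit_B \<Lambda>) (counit_B \<Lambda> ip) A\<^sub>0 v =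
    (\<Sum>i\<in>I. \<psi> (A\<^sub>0 (R * star (e i)) * v) *\<^sub>C e i)"
proof -
  have "comult_B \<Lambda> ip (unit_B \<Lambda> 1) = (\<Sum>i\<in>I. e i \<otimes>\<^sub>t (R * star (e i)))"
    by (simp add: comult_B unit_B_def unit_H_def scaleC_one)
  from bend_eq[OF clinear_mult_B clinear_comult_B clinear_unit_B _ A0_linear this, of "counit_B \<Lambda> ip" v]
  show ?thesis by (simp add: counit_B clinear_\<psi> mult_B)
qed

lemma bend_H: "bend (mult_H \<Lambda>) (comult_H \<Lambda> ip) (unit_H \<Lambda>) (counit_H \<Lambda> ip) A (\<Lambda> v) =
    \<Lambda> (bend (mult_B \<Lambda>) (comult_B \<Lambda> ip) (unit_B \<Lambda>) (counit_B \<Lambda> ip) A\<^sub>0 v)"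
proof -
  have "comult_H \<Lambda> ip (unit_H \<Lambda> 1) = (\<Sum>i\<in>I. \<Lambda> (e i) \<otimes>\<^sub>t \<Lambda> (R * star (e i)))"
    by (simp add: comult_H unit_H_def scaleC_one)
  from bend_eq[OF clinear_mult_H clinear_comult_H clinear_unit_H _ A_linear this, of "counit_H \<Lambda> ip" "\<Lambda> v"]
  show ?thesis
    by (simp add: counit_H sesquilinearD(1)[OF sesquilinear_ip] mult_H A_def ip_\<Lambda> bend_B
        clinear_sum[OF clinear_\<Lambda>] clinear_scale[OF clinear_\<Lambda>])
qed

lemma bend_iff: "bend (mult_H \<Lambda>) (comult_H \<Lambda> ip) (unit_H \<Lambda>) (counit_H \<Lambda> ip) A = A \<longleftrightarrow>
    bend (mult_B \<Lambda>) (comult_B \<Lambda> ip) (unit_B \<Lambda>) (counit_B \<Lambda> ip) A\<^sub>0 = A\<^sub>0"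
  by (simp add: fun_eq_iff all_H bend_H A_def)

lemma selfadjoint_iff: "hilbert_adj ip ip A = A \<longleftrightarrow> (\<forall>a b. \<psi> (star a * A\<^sub>0 b) = \<psi> (star (A\<^sub>0 a) * b))"
proof
  \<comment> \<open>\<open>hilbert_adj\<close> is a definite description, so an adjoint must be
    exhibited before the equation reveals anything about \<open>A\<close>; the dual frame provides
    it.\<close>
  define g where "g w = (\<Sum>i\<in>I. cnj (ip w (A (\<Lambda> (e i)))) *\<^sub>C \<Lambda> (e i * R))" for w
  note ips = sesquilinear_simps[OF sesquilinear_ip] and ipl = sesquilinearD[OF sesquilinear_ip]
  have g_lin: "clinear g"
    unfolding g_def[abs_def] by (rule clinear_sum_fun, rule clinear_coeff, rule ipl(2))
  have g: "ip w (A v) = ip (g w) v" for v w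
  proof -
    have "A v = (\<Sum>i\<in>I. ip (\<Lambda> (e i * R)) v *\<^sub>C A (\<Lambda> (e i)))"
      by (subst ip_frame[of v]) (simp only: clinear_sum[OF A_linear] clinear_scale[OF A_linear])
    then have "ip w (A v) = (\<Sum>i\<in>I. ip (\<Lambda> (e i * R)) v * ip w (A (\<Lambda> (e i))))"
      by (simp add: clinear_sum[OF ipl(1)] ips)
    moreover have "ip (g w) v = cnj (\<Sum>i\<in>I. cnj (ip (cnj (ip w (A (\<Lambda> (e i)))) *\<^sub>C \<Lambda> (e i * R)) v))"
      using arg_cong[OF clinear_sum[OF ipl(2)], of cnj] by (simp add: g_def)
    ultimately show ?thesis by (simp add: ips mult.commute)
  qed
  assume "hilbert_adj ip ip A = A"
  moreover have "hilbert_adj ip ip A = g"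
    by (rule hilbert_adj_eqI[OF sesquilinear_ip ip_nondegenerate g_lin]) (simp_all add: g)
  ultimately have "ip (\<Lambda> a) (A (\<Lambda> b)) = ip (A (\<Lambda> a)) (\<Lambda> b)" for a b using g by simp
  then show "\<forall>a b. \<psi> (star a * A\<^sub>0 b) = \<psi> (star (A\<^sub>0 a) * b)" by (simp add: A_def ip_\<Lambda>)
next
  assume "\<forall>a b. \<psi> (star a * A\<^sub>0 b) = \<psi> (star (A\<^sub>0 a) * b)"
  then have "ip w (A v) = ip (A w) v" for v w by (simp add: ip_eq A_eq)
  then show "hilbert_adj ip ip A = A"
    by - (rule hilbert_adj_eqI[OF sesquilinear_ip ip_nondegenerate A_linear])
qed

text \<open>A bend-invariant map is its own transpose for the form \<open>(a, b) \<mapsto> \<psi> (a b)\<close>, so reality and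
  self-adjointness amount to the same.\<close>

lemma bend_transpose:
  assumes bend: "bend (mult_B \<Lambda>) (comult_B \<Lambda> ip) (unit_B \<Lambda>) (counit_B \<Lambda> ip) A\<^sub>0 = A\<^sub>0"
  shows "\<psi> (w * A\<^sub>0 v) = \<psi> (A\<^sub>0 w * v)"
proof -
  \<comment> \<open>Chosen so that \<open>R * (u * Q) = w\<close>, which the frame sum produces, and
    so that \<open>\<psi> (x * u) = \<psi> (w * x)\<close> by cyclicity of the trace.\<close>
  define u where "u = Q * w * R"
  have "A\<^sub>0 v = (\<Sum>i\<in>I. \<psi> (A\<^sub>0 (R * star (e i)) * v) *\<^sub>C e i)" using bend bend_B by metis
  then have "\<psi> (A\<^sub>0 v * u) = \<psi> ((\<Sum>i\<in>I. \<psi> (A\<^sub>0 (R * star (e i)) * v) *\<^sub>C e i) * u)" by (simp only:)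
  also have "\<dots> = (\<Sum>i\<in>I. \<psi> (A\<^sub>0 (R * star (e i)) * v) * \<psi> (e i * u))"
    by (simp add: sum_distrib_right scaleC_mult_left clinear_sum[OF clinear_\<psi>] clinear_scale[OF clinear_\<psi>])
  also have "\<dots> = \<psi> (A\<^sub>0 (R * (\<Sum>i\<in>I. \<psi> (e i * u) *\<^sub>C star (e i))) * v)"
    by (simp add: sum_distrib_right sum_distrib_left scaleC_mult_left scaleC_mult_right mult.commute
        clinear_sum[OF clinear_\<psi>] clinear_scale[OF clinear_\<psi>] clinear_sum[OF A0_linear] clinear_scale[OF A0_linear])
  also have "\<dots> = \<psi> (A\<^sub>0 w * v)"
    by (simp add: \<psi>_frame_left u_def mult.assoc RQ Q_R_cancel)
  finally have 1: "\<psi> (A\<^sub>0 v * u) = \<psi> (A\<^sub>0 w * v)" .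
  have "\<psi> (A\<^sub>0 v * u) = \<tau> (Q * (A\<^sub>0 v * (Q * (w * R))))" by (simp add: density u_def mult.assoc)
  also have "\<dots> = \<tau> (A\<^sub>0 v * (Q * (w * (R * Q))))"
    using trace_commute[of Q "A\<^sub>0 v * (Q * (w * R))"] by (simp add: mult.assoc)
  also have "\<dots> = \<tau> (A\<^sub>0 v * (Q * w))" by (simp add: RQ)
  also have "\<dots> = \<psi> (w * A\<^sub>0 v)"
    using trace_commute[of "A\<^sub>0 v" "Q * w"] by (simp add: density mult.assoc)
  finally show ?thesis by (simp add: 1)
qed

lemma real_iff_selfadjoint:
  assumes "bend (mult_B \<Lambda>) (comult_B \<Lambda> ip) (unit_B \<Lambda>) (counit_B \<Lambda> ip) A\<^sub>0 = A\<^sub>0"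
  shows "real_map A\<^sub>0 \<longleftrightarrow> hilbert_adj ip ip A = A"
proof
  assume "real_map A\<^sub>0"
  then show "hilbert_adj ip ip A = A"
    by (simp add: selfadjoint_iff bend_transpose[OF assms] real_map_def)
next
  assume "hilbert_adj ip ip A = A"
  then have eq: "\<psi> (A\<^sub>0 (star a) * b) = \<psi> (star (A\<^sub>0 a) * b)" for a b
    using bend_transpose[OF assms] by (simp add: selfadjoint_iff)
  show "real_map A\<^sub>0"
    unfolding real_map_def
  proof
    fix a
    \<comment> \<open>An element \<open>c\<close> is determined by the values
      \<open>\<psi> (c * e i)\<close>, and \<open>eq\<close> says that these agree.\<close>
    have "A\<^sub>0 (star a) = (\<Sum>i\<in>I. \<psi> (A\<^sub>0 (star a) * e i) *\<^sub>C (R * star (e i)))"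
      by (rule \<psi>_frame'[symmetric])
    also have "\<dots> = star (A\<^sub>0 a)" by (simp only: eq \<psi>_frame')
    finally show "A\<^sub>0 (star a) = star (A\<^sub>0 a)" .
  qed
qed

text \<open>The elements multiplying \<open>a\<close> and \<open>b\<close> on the left are the same
  and independent of both. This uniformity is what gives positivity for matrices of every
  size.\<close>

lemma schur_real_gram:
  assumes schur: "\<And>b. A\<^sub>0 b = (\<Sum>i\<in>I. A\<^sub>0 (b * e i) * A\<^sub>0 (R * star (e i)))" and real: "real_map A\<^sub>0"
  shows "A\<^sub>0 (star a * b) =
    (\<Sum>i\<in>I. star (A\<^sub>0 (R * star y * star (e i) * a)) * A\<^sub>0 (R * star y * star (e i) * b))"
proof -
  \<comment> \<open>With this choice \<open>T * star T = R * Q * R = R\<close>, so \<open>T\<close>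
    carries one half of \<open>R\<close>.\<close>
  define T where "T = R * star y"
  have TT: "T * star T = R"
    using arg_cong[OF RQ, of "\<lambda>x. x * R"] by (simp add: T_def star_mult star_star star_R Q_eq mult.assoc)
  note A0 = clinear_add[OF A0_linear] clinear_scale[OF A0_linear]
  note bil = distrib_left distrib_right scaleC_mult_left scaleC_mult_right A0
  have \<beta>1: "cbilinear (\<lambda>u v. A\<^sub>0 (star a * u) * A\<^sub>0 (R * v))"
    by (rule cbilinearI; rule clinearI) (simp_all add: bil)
  have \<beta>2: "cbilinear (\<lambda>u v. A\<^sub>0 (star a * u) * A\<^sub>0 (v * b))"
    by (rule cbilinearI; rule clinearI) (simp_all add: bil)
  have \<beta>3: "cbilinear (\<lambda>u v. A\<^sub>0 (star a * (u * star T)) * A\<^sub>0 (v * b))"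
    by (rule cbilinearI; rule clinearI) (simp_all add: bil)
  have "A\<^sub>0 (star a * b) = (\<Sum>i\<in>I. A\<^sub>0 (star a * (b * e i)) * A\<^sub>0 (R * star (e i)))"
    by (subst schur) (simp add: mult.assoc)
  also have "\<dots> = (\<Sum>i\<in>I. A\<^sub>0 (star a * e i) * A\<^sub>0 (R * star (e i) * b))"
    by (subst casimir_left[OF \<beta>1]) (simp add: mult.assoc)
  \<comment> \<open>All of \<open>R\<close> goes to the left leg as \<open>T * star T\<close>, and
    then \<open>T\<close> returns to the right leg; so each leg ends up with one half, in adjoint
    position to the other.\<close>
  also have "\<dots> = (\<Sum>i\<in>I. A\<^sub>0 (star a * (e i * T * star T)) * A\<^sub>0 (star (e i) * b))"
    by (subst casimir_right[OF \<beta>2, symmetric]) (simp add: mult.assoc TT)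
  also have "\<dots> = (\<Sum>i\<in>I. A\<^sub>0 (star a * (e i * star T)) * A\<^sub>0 (T * star (e i) * b))"
    by (rule casimir_right[OF \<beta>3])
  finally have sum: "A\<^sub>0 (star a * b) =
    (\<Sum>i\<in>I. A\<^sub>0 (star a * (e i * star T)) * A\<^sub>0 (T * star (e i) * b))" .
  have "A\<^sub>0 (star a * (e i * star T)) = star (A\<^sub>0 (T * star (e i) * a))" for i
  proof -
    have "star a * (e i * star T) = star (T * star (e i) * a)"
      by (simp add: star_mult star_star mult.assoc)
    then show ?thesis using real by (simp add: real_map_def)
  qed
  then show ?thesis by (simp only: sum T_def)
qed

text \<open>Each description is resolved to an explicit sum over the frame. The two sums agree term
  by term on \<open>A\<^sub>0\<close> and \<open>A\<close>, since \<open>\<sigma>_star\<close>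
  expresses both prescriptions through the same \<open>\<sigma>\<close>.\<close>

lemma Psi'_eq_Psi'_0_half:
  assumes log: "star (cstar_log Q) = cstar_log Q"
  shows "Psi' \<psi> Q A\<^sub>0 = Psi'_0_half \<Lambda> ip Q A"
proof -
  define \<sigma> where "\<sigma> a = to_opp (modular Q (- \<i> / 2) a)" for a
  have \<sigma>_lin: "clinear \<sigma>"
    unfolding \<sigma>_def[abs_def] by (rule clinear_compose[OF clinear_modular clinear_to_opp])
  have \<sigma>_star: "to_opp (star (modular Q (\<i> / 2) a)) = \<sigma> (star a)" for a
    by (simp add: \<sigma>_def star_modular[OF log])
  note el = cbilinearD[OF elem_tensor_bilinear]
  \<comment> \<open>The left side is the candidate sum at a rank-one map;
    \<open>\<psi>_frame'\<close> restores \<open>a\<close> inside \<open>\<sigma>\<close>.\<close>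
  have frame: "(\<Sum>i\<in>I. (\<psi> (a * e i) *\<^sub>C c) \<otimes>\<^sub>t \<sigma> (R * star (e i))) = c \<otimes>\<^sub>t \<sigma> a" for a c
  proof -
    have "\<sigma> a = (\<Sum>i\<in>I. \<psi> (a * e i) *\<^sub>C \<sigma> (R * star (e i)))"
      by (subst \<psi>_frame'[of a, symmetric]) (simp only: clinear_sum[OF \<sigma>_lin] clinear_scale[OF \<sigma>_lin])
    then show ?thesis
      by (simp add: clinear_sum[OF el(1)] clinear_scale[OF el(1)] clinear_scale[OF el(2)])
  qed
  define N where "N = restrict (\<lambda>f :: 'b \<Rightarrow> 'b. \<Sum>i\<in>I. f (e i) \<otimes>\<^sub>t \<sigma> (R * star (e i))) {f. clinear f}"
  have N: "linear_on_endos N"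
    unfolding N_def by (rule linear_on_endos_frame[OF clinear_id])
  have lin: "clinear (\<lambda>x. \<psi> (a * x))" for a by (rule clinear_compose[OF clinear_mult_left clinear_\<psi>])
  have N_one: "N (\<lambda>x. \<psi> (a * x) *\<^sub>C c) = c \<otimes>\<^sub>t \<sigma> a" for a c
    by (simp add: N_def clinear_coeff[OF lin] frame)
  have "Psi' \<psi> Q = N"
    unfolding Psi'_def \<sigma>_def[symmetric]
  proof (rule the_equality)
    fix P assume P: "linear_on_endos P \<and> (\<forall>a c. P (\<lambda>x. \<psi> (a * x) *\<^sub>C c) = c \<otimes>\<^sub>t \<sigma> a)"
    show "P = N"
      by (rule linear_on_endos_eqI[where \<phi> = "\<lambda>i x. \<psi> (R * star (e i) * x)" and e = e, OF _ N finite_I lin \<psi>_frame])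
        (use P N_one in auto)
  qed (simp add: N N_one)
  define M where "M = restrict (\<lambda>f :: 'h \<Rightarrow> 'h. \<Sum>i\<in>I. V (f (\<Lambda> (e i))) \<otimes>\<^sub>t \<sigma> (R * star (e i))) {f. clinear f}"
  have M: "linear_on_endos M"
    unfolding M_def by (rule linear_on_endos_frame[OF clinear_V])
  have M_one: "M (rank_one ip (\<Lambda> a) (\<Lambda> b)) = b \<otimes>\<^sub>t \<sigma> (star a)" for a b
    by (simp add: M_def rank_one_def clinear_coeff[OF sesquilinearD(1)[OF sesquilinear_ip]] ip_\<Lambda>
        clinear_scale[OF clinear_V] frame)
  have "Psi'_0_half \<Lambda> ip Q = M"
    unfolding Psi'_0_half_def \<sigma>_star
  proof (rule the_equality)
    fix P assume P: "linear_on_endos P \<and> (\<forall>a b. P (rank_one ip (\<Lambda> a) (\<Lambda> b)) = b \<otimes>\<^sub>t \<sigma> (star a))"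
    have "P (\<lambda>x. ip (\<Lambda> (e i * R)) x *\<^sub>C \<xi>) = M (\<lambda>x. ip (\<Lambda> (e i * R)) x *\<^sub>C \<xi>)" for i \<xi>
      using P M_one[of "e i * R" "V \<xi>"] by (simp flip: rank_one_def) (metis \<Lambda>_V)
    then show "P = M"
      using P by (intro linear_on_endos_eqI[where \<phi> = "\<lambda>i. ip (\<Lambda> (e i * R))" and e = "\<lambda>i. \<Lambda> (e i)",
            OF _ M finite_I sesquilinearD(1)[OF sesquilinear_ip] ip_frame]) simp_all
  qed (simp add: M M_one)
  have "N A\<^sub>0 = M A" by (simp add: N_def M_def A0_linear A_linear A_def)
  then show ?thesis by (simp add: \<open>Psi' \<psi> Q = N\<close> \<open>Psi'_0_half \<Lambda> ip Q = M\<close>)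
qed

end

end

section \<open>The identity of the two maps and the equivalences for \<open>A\<^sub>0\<close> and
  \<open>A\<close>\<close>

theorem theorem5p37:
  fixes \<Phi> :: "'b::fd_cstar_algebra \<Rightarrow> nat \<Rightarrow> complex mat"
    and \<psi> :: "'b \<Rightarrow> complex" and Q :: 'b
    and \<Lambda> :: "'b \<Rightarrow> 'h::complex_vector" and ip :: "'h \<Rightarrow> 'h \<Rightarrow> complex"
    and A\<^sub>0 :: "'b \<Rightarrow> 'b" and A :: "'h \<Rightarrow> 'h"
  assumes blocks: "matrix_blocks K d \<Phi>"
    and state: "faithful_state \<psi>"
    and Q_pos: "cstar_pos Q" and Q_inv: "\<exists>R. Q * R = 1 \<and> R * Q = 1"
    and Q_density: "\<And>a. \<psi> a = block_trace K d \<Phi> (Q * a)"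
    and gns: "gns \<psi> \<Lambda> ip"
    and A0_linear: "clinear A\<^sub>0"
    and A_def: "\<And>a. A (\<Lambda> a) = \<Lambda> (A\<^sub>0 a)"
  shows "Psi' \<psi> Q A\<^sub>0 = Psi'_0_half \<Lambda> ip Q A
    \<and> (completely_positive A\<^sub>0
          \<and> schur_square (mult_B \<Lambda>) (comult_B \<Lambda> ip) A\<^sub>0 = A\<^sub>0
        \<longleftrightarrow>
        real_map A\<^sub>0
          \<and> schur_square (mult_H \<Lambda>) (comult_H \<Lambda> ip) A = A)
    \<and> (completely_positive A\<^sub>0
          \<and> schur_square (mult_B \<Lambda>) (comult_B \<Lambda> ip) A\<^sub>0 = A\<^sub>0
          \<and> bend (mult_B \<Lambda>) (comult_B \<Lambda> ip) (unit_B \<Lambda>) (counit_B \<Lambda> ip) A\<^sub>0 = A\<^sub>0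
        \<longleftrightarrow>
        hilbert_adj ip ip A = A
          \<and> schur_square (mult_H \<Lambda>) (comult_H \<Lambda> ip) A = A
          \<and> bend (mult_H \<Lambda>) (comult_H \<Lambda> ip) (unit_H \<Lambda>) (counit_H \<Lambda> ip) A = A)"
proof -
  interpret B: blocks K d \<Phi> by unfold_locales (rule blocks)
  obtain R where R: "Q * R = 1" "R * Q = 1" using Q_inv by auto
  obtain y where y: "Q = star y * y" using Q_pos by (auto simp: cstar_pos_def)
  obtain I and e :: "nat \<times> nat \<times> nat \<Rightarrow> 'b"
    where I: "finite I" "\<And>b. b = (\<Sum>x\<in>I. B.\<tau> (star (e x) * b) *\<^sub>C e x)"
    by (rule B.ex_orthonormal_basis) (rule that)
  interpret G: gns_frame B.\<tau> \<psi> Q R y \<Lambda> ip I e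
    by (rule gns_frame.intro[OF B.clinear_trace B.trace_commute B.trace_star I y R Q_density gns])
  note lin = A0_linear A_def
  have log: "star (cstar_log Q) = cstar_log Q"
    by (rule star_cstar_log[OF state Q_pos R(2)])
  \<comment> \<open>The implication from reality to complete positivity is the one that uses Schur
    idempotence; its converse is \<open>completely_positive_imp_real\<close>.\<close>
  have cp: "completely_positive A\<^sub>0"
    if real: "real_map A\<^sub>0" and schur: "schur_square (mult_B \<Lambda>) (comult_B \<Lambda> ip) A\<^sub>0 = A\<^sub>0"
    unfolding completely_positive_def
  proof (intro conjI allI impI A0_linear)
    fix n and X :: "'b mat" assume "mat_pos n X"
    then obtain Y where X: "X \<in> carrier_mat n n"
      and Y: "\<And>p q. p < n \<Longrightarrow> q < n \<Longrightarrow> X $$ (p, q) = (\<Sum>s<n. star (Y s p) * Y s q)"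
      by (auto simp: mat_pos_iff)
    have A0_schur: "A\<^sub>0 b = (\<Sum>i\<in>I. A\<^sub>0 (b * e i) * A\<^sub>0 (R * star (e i)))" for b
      using fun_cong[OF schur, of b] by (simp add: G.schur_B[OF lin])
    \<comment> \<open>Each summand \<open>s\<close> of an entry of \<open>X\<close> splits further
      over the frame index \<open>i\<close>, so pairs index the resulting squares.\<close>
    define Z where "Z = (\<lambda>(s, i) p. A\<^sub>0 (R * star y * star (e i) * Y s p))"
    have Z: "A\<^sub>0 (X $$ (p, q)) = (\<Sum>r\<in>{..<n} \<times> I. star (Z r p) * Z r q)" if "p < n" "q < n" for p q
      by (simp add: Y[OF that] clinear_sum[OF A0_linear] G.schur_real_gram[OF lin A0_schur real]
          Z_def sum.cartesian_product split_beta)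
    have fin: "finite ({..<n} \<times> I)" using I(1) by simp
    \<comment> \<open>\<open>mat_pos\<close> demands a factor with \<open>n\<close> rows, while the
      sum runs over \<open>{..<n} \<times> I\<close>.\<close>
    obtain W where W: "\<And>p q. p < n \<Longrightarrow> q < n \<Longrightarrow>
        (\<Sum>r\<in>{..<n} \<times> I. star (Z r p) * Z r q) = (\<Sum>s<n. star (W s p) * W s q)"
      by (rule B.ex_square_factor[OF fin, of n Z]) (rule that)
    show "mat_pos n (map_mat A\<^sub>0 X)"
      unfolding mat_pos_iff using X by (auto intro!: exI[of _ W] simp: Z W)
  qed
  \<comment> \<open>Both sides of the second equivalence contain the bending condition, under which
    reality and self-adjointness may be exchanged; the rest is propositional.\<close>
  show ?thesis
    using G.Psi'_eq_Psi'_0_half[OF lin log] cp completely_positive_imp_real[of A\<^sub>0]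
      G.schur_iff[OF lin] G.bend_iff[OF lin] G.real_iff_selfadjoint[OF lin]
    by argo
qed

end
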